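(* Let $f:\mathbb{R}^n\times\Theta\to\mathbb{R}$ satisfy (A.1)–(A.3) and assume in addition that $f$ is strongly convex with respect to $x$ (for each $\theta\in\Theta$). For $\theta\in\Theta$, let $x^\star(\theta)$ be the unique minimizer of $f(\cdot,\theta)$ and $X^\star(\theta)=(x^\star(\theta),x^\star(\theta))\in\mathbb{R}^{2n}$. Let $(X_k(\theta))_{k\in\mathbb{N}}$, $X_k(\theta)=(x_k(\theta),x_{k-1}(\theta))$, be generated by the inertial method described in the context, whose parameters satisfy conditions (B), (C.1) and (C.2). Assume that $X_0:\Theta\to\mathbb{R}^{2n}$ is continuously differentiable with respect to $\theta$. Let $M$ be the matrix defined in the context and $\rho(M)$ its spectral radius. Then, for each $\theta\in\Theta$ and every $\varepsilon>0$ small enough, there exists $K$ large enough such that for all $k\ge K$, $$\|\partial_\theta X_{k+1}(\theta)-\partial_\theta X^\star(\theta)\|\le 2\rho(M)\,\|\partial_\theta X_k(\theta)-\partial_\theta X^\star(\theta)\|+\varepsilon\bigl(2+\|\partial_\theta X_k(\theta)-\partial_\theta X^\star(\theta)\|\bigr).$$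
   Context: $\Theta\subseteq\mathbb{R}^m$ is open. The problem is $\min_{x\in\mathbb{R}^n}f(x,\theta)$ for $\theta\in\Theta$. $\partial_\theta$ denotes the Jacobian with respect to $\theta$ (so $\partial_\theta X_k(\theta)\in\mathbb{R}^{2n\times m}$). Conditions on $f$: (A.1) $f$ is $C^2$-smooth with respect to both $x,\theta$; (A.2) $\nabla_xf$ is $L$-Lipschitz continuous in both $x,\theta$; (A.3) for all $\theta\in\Theta$, $x\mapsto f(x,\theta)$ is level bounded (all sublevel sets are bounded). Inertial method: with $a_k\in[0,\bar a]$, $\bar a\le1$, $b_k\in[0,\bar b]$, $\bar b\le1$, $0<\gamma_k<2/L$, and $x_{-1}=x_0$ (so $X_0=(x_0,x_0)$, which may depend on $\theta$), for $k=0,1,\dots$ $$y_{a_k}=x_k+a_k(x_k-x_{k-1}),\quad y_{b_k}=x_k+b_k(x_k-x_{k-1}),\quad x_{k+1}=y_{a_k}-\gamma_k\nabla_xf(y_{b_k},\theta).$$ (B) There exists a constant $\tau>0$ such that one of the following holds: - for all $k\in\mathbb{N}$, $\tau<(1+a_k)-\frac{\gamma_kL}{2}(1+b_k)^2$, with $a_k<\frac{\gamma_kL}{2}b_k$; - for all $k\in\mathbb{N}$, $\tau<(1-3a_k)-\frac{\gamma_kL}{2}(1-b_k)^2$, with $b_k\le a_k$ or $\frac{\gamma_kL}{2}b_k\le a_k<b_k$. (C.1) There exist $a,b\in[0,1]$ and $\gamma\in(0,\frac2L)$ such that $a_k\to a$, $b_k\to b$ and $\gamma_k\to\gamma$. (C.2)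 Given any limit points $a,b$ of $(a_k),(b_k)$ respectively, with $(a,b)\in[0,1)^2$, one has $\frac{2(b-a)-1}{1+2b}<\underline{\eta}_\theta$, where $\underline{\eta}_\theta$ is the smallest eigenvalue of $G_\theta=\mathrm{Id}-\gamma\nabla_x^2f(x^\star(\theta),\theta)$. The matrix $M$ (depending on $\theta$), with $a,b,\gamma$ from (C.1), is $$M=\begin{pmatrix}(1+a)\mathrm{Id}-\gamma(1+b)\nabla_x^2f(x^\star(\theta),\theta)&-a\mathrm{Id}+\gamma b\nabla_x^2f(x^\star(\theta),\theta)\\ \mathrm{Id}&0\end{pmatrix}.$$ *)

theory Defs
  imports "HOL-Analysis.Analysis"
begin

section \<open>Smoothness and convexity\<close>

definition C1_on :: "'a::real_normed_vector set \<Rightarrow> ('a \<Rightarrow> 'b::real_normed_vector) \<Rightarrow> bool" where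
  "C1_on S g \<longleftrightarrow> (\<exists>g' :: 'a \<Rightarrow> 'a \<Rightarrow>\<^sub>L 'b.
     (\<forall>x\<in>S. (g has_derivative blinfun_apply (g' x)) (at x)) \<and> continuous_on S g')"

definition C2_on :: "'a::real_normed_vector set \<Rightarrow> ('a \<Rightarrow> 'b::real_normed_vector) \<Rightarrow> bool" where
  "C2_on S g \<longleftrightarrow> (\<exists>g' :: 'a \<Rightarrow> 'a \<Rightarrow>\<^sub>L 'b.
     (\<forall>x\<in>S. (g has_derivative blinfun_apply (g' x)) (at x)) \<and> C1_on S g')"

definition gradient :: "('a::real_inner \<Rightarrow> real) \<Rightarrow> 'a \<Rightarrow> 'a" where
  "gradient g x = (THE D. GDERIV g x :> D)"

lemma gradient_eqI:
  assumes "GDERIV g x :> D"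
  shows "gradient g x = D"
  unfolding gradient_def
proof (rule the_equality)
  fix D' assume "GDERIV g x :> D'"
  with assms have "(\<lambda>h. h \<bullet> D') = (\<lambda>h. h \<bullet> D)"
    unfolding gderiv_def by (rule has_derivative_unique[rotated])
  then show "D' = D"
    by (metis vector_eq_rdot inner_commute)
qed (fact assms)

definition hessian :: "(real^'n \<Rightarrow> real) \<Rightarrow> real^'n \<Rightarrow> real^'n^'n" where
  "hessian g x = jacobian (gradient g) (at x)"

definition strongly_convex :: "('a::real_normed_vector \<Rightarrow> real) \<Rightarrow> bool" where
  "strongly_convex g \<longleftrightarrow> (\<exists>\<mu>>0. \<forall>x y. \<forall>t\<in>{0..1}.
     g ((1 - t) *\<^sub>R x + t *\<^sub>R y)
       \<le> (1 - t) * g x + t * g y - \<mu> / 2 * t * (1 - t) * (norm (x - y))\<^sup>2)"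

definition level_bounded :: "('a::real_normed_vector \<Rightarrow> real) \<Rightarrow> bool" where
  "level_bounded g \<longleftrightarrow> (\<forall>\<alpha>. bounded {x. g x \<le> \<alpha>})"

definition minimizer :: "('a \<Rightarrow> real) \<Rightarrow> 'a" where
  "minimizer g = (THE x. \<forall>y. g x \<le> g y)"

definition seq_limit_point :: "(nat \<Rightarrow> real) \<Rightarrow> real \<Rightarrow> bool" where
  "seq_limit_point s l \<longleftrightarrow> (\<exists>r. strict_mono r \<and> (s \<circ> r) \<longlonglongrightarrow> l)"


section \<open>Matrices\<close>

definition eigenvalues :: "'a::field^'k^'k \<Rightarrow> 'a set" where
  "eigenvalues A = {z. \<exists>v. v \<noteq> 0 \<and> A *v v = z *s v}"

definition spectral_radius :: "real^'k^'k \<Rightarrow> real" where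
  "spectral_radius A = Max (cmod ` eigenvalues (map_matrix complex_of_real A))"

text \<open>Only real eigenvalues are considered here; this is used for symmetric matrices only.\<close>
definition smallest_eigenvalue :: "real^'k^'k \<Rightarrow> real" where
  "smallest_eigenvalue A = Min (eigenvalues A)"

text \<open>The norm on matrices is the operator norm induced by the Euclidean norms; the type class
  norm on \<^typ>\<open>real^'m^'k\<close> would be the Frobenius norm.\<close>
definition op_norm :: "real^'m^'k \<Rightarrow> real" where
  "op_norm A = onorm ((*v) A)"

text \<open>The space of pairs of vectors in \<^typ>\<open>real^'n\<close> is represented as \<^typ>\<open>real^('n + 'n)\<close>.\<close>
definition stack :: "'a^'n \<Rightarrow> 'a^'n \<Rightarrow> 'a^('n + 'n)" where
  "stack x y = (\<chi> i. case i of Inl p \<Rightarrow> x $ p | Inr p \<Rightarrow> y $ p)"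

definition block_matrix ::
    "'a^'n^'n \<Rightarrow> 'a^'n^'n \<Rightarrow> 'a^'n^'n \<Rightarrow> 'a^'n^'n \<Rightarrow> 'a^('n + 'n)^('n + 'n)" where
  "block_matrix A B C D = (\<chi> i. case i of
       Inl p \<Rightarrow> stack (A $ p) (B $ p)
     | Inr p \<Rightarrow> stack (C $ p) (D $ p))"


section \<open>The inertial method\<close>

text \<open>\<open>inertial_pair f a b \<gamma> x0 \<theta> k\<close> is the pair of the iterates with indices \<open>k\<close> and
  \<open>k - 1\<close>; the iterates with indices \<open>0\<close> and \<open>- 1\<close> are both \<open>x0 \<theta>\<close>.\<close>
primrec inertial_pair ::
    "('x::real_inner \<Rightarrow> 't \<Rightarrow> real) \<Rightarrow> (nat \<Rightarrow> real) \<Rightarrow> (nat \<Rightarrow> real) \<Rightarrow> (nat \<Rightarrow> real)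
      \<Rightarrow> ('t \<Rightarrow> 'x) \<Rightarrow> 't \<Rightarrow> nat \<Rightarrow> 'x \<times> 'x" where
  "inertial_pair f a b \<gamma> x0 \<theta> 0 = (x0 \<theta>, x0 \<theta>)"
| "inertial_pair f a b \<gamma> x0 \<theta> (Suc k) =
     (let (x, x') = inertial_pair f a b \<gamma> x0 \<theta> k;
          ya = x + a k *\<^sub>R (x - x');
          yb = x + b k *\<^sub>R (x - x')
      in (ya - \<gamma> k *\<^sub>R gradient (\<lambda>z. f z \<theta>) yb, x))"

definition inertial_state ::
    "(real^'n \<Rightarrow> 't \<Rightarrow> real) \<Rightarrow> (nat \<Rightarrow> real) \<Rightarrow> (nat \<Rightarrow> real) \<Rightarrow> (nat \<Rightarrow> real)
      \<Rightarrow> ('t \<Rightarrow> real^'n) \<Rightarrow> nat \<Rightarrow> 't \<Rightarrow> real^('n + 'n)" where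
  "inertial_state f a b \<gamma> x0 k \<theta> =
     (case inertial_pair f a b \<gamma> x0 \<theta> k of (x, x') \<Rightarrow> stack x x')"

definition optimal_point :: "('x \<Rightarrow> 't \<Rightarrow> real) \<Rightarrow> 't \<Rightarrow> 'x" where
  "optimal_point f \<theta> = minimizer (\<lambda>x. f x \<theta>)"

definition inertial_matrix :: "real \<Rightarrow> real \<Rightarrow> real \<Rightarrow> real^'n^'n \<Rightarrow> real^('n + 'n)^('n + 'n)" where
  "inertial_matrix a b \<gamma> H = block_matrix
     ((1 + a) *\<^sub>R mat 1 - (\<gamma> * (1 + b)) *\<^sub>R H)  (- a *\<^sub>R mat 1 + (\<gamma> * b) *\<^sub>R H)
     (mat 1)                               0"

definition param_condition :: "real \<Rightarrow> (nat \<Rightarrow> real) \<Rightarrow> (nat \<Rightarrow> real) \<Rightarrow> (nat \<Rightarrow> real) \<Rightarrow> bool" where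
  "param_condition L a b \<gamma> \<longleftrightarrow> (\<exists>\<tau>>0.
     (\<forall>k. \<tau> < (1 + a k) - \<gamma> k * L / 2 * (1 + b k)\<^sup>2 \<and> a k < \<gamma> k * L / 2 * b k) \<or>
     (\<forall>k. \<tau> < (1 - 3 * a k) - \<gamma> k * L / 2 * (1 - b k)\<^sup>2 \<and>
          (b k \<le> a k \<or> \<gamma> k * L / 2 * b k \<le> a k \<and> a k < b k)))"

end

theory Submission
  imports Defs "HOL-Computational_Algebra.Fundamental_Theorem_Algebra"
begin

text \<open>
The error of the Jacobians tends to zero, and this already gives the estimate: once both
\<^term>\<open>op_norm (jacobian (X k) (at \<theta>) - jacobian Xstar (at \<theta>))\<close> and its successor are below
\<open>\<epsilon>\<close>, the left-hand side is at most \<open>\<epsilon>\<close>, while the right-hand side is at least \<open>2 * \<epsilon>\<close>, since the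
spectral radius is nonnegative. For the latter one only has to know that a complex matrix has
finitely many eigenvalues and at least one.

The convergence of the iterates and that of their derivatives are two instances of one statement,
\<open>inexact_inertial_method_converges\<close>: the inertial method converges for a strongly convex function
with Lipschitz gradient \<open>G\<close> even if \<open>G\<close> is evaluated with an error that is \<open>o(1 + \<parallel>y - x\<^sup>\<star>\<parallel>)\<close>. Its proof
uses the energy \<open>F x - F x\<^sup>\<star> + c * \<parallel>d\<parallel>\<^sup>2\<close>, where \<open>d\<close> is the last step. Convexity and the descent lemma
show that the energy decreases by a multiple of the squared steps as soon as, with
\<open>s = \<gamma> * L / 2\<close>, the quantity \<open>1 - s - \<bar>a - 2 * s * b\<bar> - s * b\<^sup>2\<close> is bounded away from zero. Both
alternatives of the parameter condition imply this bound (\<open>param_condition_margin\<close>). Strong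
convexity bounds the energy by the squared steps in turn, so the energy contracts.

Without errors this yields that the iterates converge to the minimizer. Differentiating the
recursion in a direction \<open>h\<close> gives again an inertial method: it minimizes the quadratic
\<open>z \<mapsto> (z - z\<^sup>\<star>) \<bullet> H (z - z\<^sup>\<star>) / 2\<close>, where \<open>H\<close> is the Hessian at the minimizer and \<open>z\<^sup>\<star>\<close> is the
derivative of the minimizer in direction \<open>h\<close>. The error comes from evaluating the second
derivatives at the iterates instead of at their limit; it has the admissible size by continuity of
the second derivatives. Strong convexity and smoothness pass to this quadratic by rescaling around
the minimizer (\<open>strongly_convex_smooth_linearization\<close>).
\<close>

section \<open>Eigenvalues of complex matrices\<close>

lemma poly_det:
  fixes P :: "'a::comm_ring_1 poly^'k^'k"
  shows "poly (det P) z = det (map_matrix (\<lambda>p. poly p z) P)"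
  by (simp add: det_def poly_sum poly_prod poly_of_int map_matrix_def)

lemma eigenvalues_iff_det_eq_0:
  fixes A :: "'a::field^'k^'k"
  shows "z \<in> eigenvalues A \<longleftrightarrow> det (mat z - A) = 0"
proof -
  have "A *v v = z *s v \<longleftrightarrow> (mat z - A) *v v = 0" for v
  proof -
    have "mat z *v v = z *s v"
      by (simp add: vec_eq_iff matrix_vector_mult_def mat_def if_distrib[of "\<lambda>c. c * _"] sum.delta cong: if_cong)
    then show ?thesis
      by (auto simp: matrix_vector_mult_diff_rdistrib)
  qed
  then have "z \<in> eigenvalues A \<longleftrightarrow> (\<exists>v. v \<noteq> 0 \<and> (mat z - A) *v v = 0)"
    by (auto simp: eigenvalues_def)
  also have "\<dots> \<longleftrightarrow> \<not> invertible (mat z - A)"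
    using matrix_left_invertible_ker[of "mat z - A"] invertible_left_inverse[of "mat z - A"] by blast
  finally show ?thesis
    by (simp add: invertible_det_nz)
qed

text \<open>For \<open>u z = 1 / z\<close> the determinant is the characteristic polynomial divided by its expected leading
power of \<open>z\<close>, so the limit determines its growth at infinity.\<close>

lemma tendsto_det_mat_1_minus_scaled:
  fixes A :: "complex^'k^'k"
  assumes "(u \<longlongrightarrow> 0) F"
  shows "((\<lambda>z. det (mat 1 - map_matrix ((*) (u z)) A)) \<longlongrightarrow> 1) F"
proof -
  have "((\<lambda>z. \<Sum>p | p permutes (UNIV::'k set). of_int (sign p) *
           (\<Prod>i\<in>UNIV. mat 1 $ i $ p i - u z * A $ i $ p i))
         \<longlongrightarrow> (\<Sum>p | p permutes (UNIV::'k set). of_int (sign p) *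
           (\<Prod>i\<in>UNIV. mat 1 $ i $ p i - 0 * A $ i $ p i))) F"
    by (intro tendsto_intros assms)
  then show ?thesis
    using det_I[where 'a=complex and 'n='k] by (simp add: det_def map_matrix_def)
qed

text \<open>The characteristic polynomial behaves like \<open>z ^ n\<close> with \<open>n \<ge> 1\<close> at infinity, so it is not constant.
Hence it has a root, by the fundamental theorem of algebra, and only finitely many.\<close>

lemma complex_eigenvalues_finite_nonempty:
  fixes A :: "complex^'k^'k"
  shows "finite (eigenvalues A)" "eigenvalues A \<noteq> {}"
proof -
  define P :: "complex poly^'k^'k" where
    "P = (\<chi> i j. (if i = j then [:0, 1:] else 0) - [:A $ i $ j:])"
  have poly_P: "poly (det P) z = det (mat z - A)" for z
    unfolding poly_det by (rule arg_cong[where f = det]) (simp add: P_def map_matrix_def vec_eq_iff mat_def)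
  have eig: "eigenvalues A = {z. poly (det P) z = 0}"
    by (auto simp: eigenvalues_iff_det_eq_0 poly_P)
  have asymp: "((\<lambda>z. poly (det P) z / z ^ CARD('k)) \<longlongrightarrow> 1) at_infinity"
  proof (rule Lim_transform_eventually)
    show "((\<lambda>z. det (mat 1 - map_matrix ((*) (inverse z)) A)) \<longlongrightarrow> 1) at_infinity"
      by (rule tendsto_det_mat_1_minus_scaled) (rule tendsto_inverse_0)
    show "\<forall>\<^sub>F z in at_infinity. det (mat 1 - map_matrix ((*) (inverse z)) A)
            = poly (det P) z / z ^ CARD('k)"
    proof (rule eventually_mono[OF eventually_not_equal_at_infinity[of 0]])
      fix z :: complex assume z: "z \<noteq> 0"
      have "mat z - A = (\<chi> i. z *s (mat 1 - map_matrix ((*) (inverse z)) A) $ i)"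
        using z by (simp add: vec_eq_iff mat_def map_matrix_def algebra_simps)
      then have "det (mat z - A) = z ^ CARD('k) * det (mat 1 - map_matrix ((*) (inverse z)) A)"
        by (simp only: det_rows_mul vec_lambda_eta prod_constant)
      then show "det (mat 1 - map_matrix ((*) (inverse z)) A) = poly (det P) z / z ^ CARD('k)"
        using z by (simp add: poly_P)
    qed
  qed
  have not_const: False if c: "\<And>z. poly (det P) z = c" for c
  proof -
    have "((\<lambda>z::complex. c / z ^ CARD('k)) \<longlongrightarrow> 0) at_infinity"
      by (intro tendsto_divide_0[OF tendsto_const] filterlim_power_at_infinity filterlim_ident) simp
    with asymp show False
      using tendsto_unique[of at_infinity] c by (metis (no_types, lifting) ext trivial_limit_at_infinity zero_neq_one)
  qed
  show "finite (eigenvalues A)"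
    unfolding eig by (rule poly_roots_finite) (use not_const[of 0] in auto)
  have "\<not> constant (poly (det P))"
    using not_const[of "poly (det P) 0"] unfolding constant_def by metis
  from fundamental_theorem_of_algebra[OF this] show "eigenvalues A \<noteq> {}"
    unfolding eig by auto
qed

text \<open>The spectral radius is itself the modulus of an eigenvalue, because the set of eigenvalues is finite
and nonempty; otherwise \<^const>\<open>Max\<close> would be unspecified.\<close>

lemma spectral_radius_nonneg: "0 \<le> spectral_radius A"
proof -
  let ?E = "eigenvalues (map_matrix complex_of_real A)"
  have "Max (cmod ` ?E) \<in> cmod ` ?E"
    by (intro Max_in) (simp_all add: complex_eigenvalues_finite_nonempty)
  then show ?thesis
    by (auto simp: spectral_radius_def)
qed

section \<open>Strongly convex functions with Lipschitz gradient\<close>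

text \<open>The two inequalities express \<open>\<mu>\<close>-strong convexity and \<open>L\<close>-smoothness of \<open>F\<close> with gradient \<open>G\<close>, but
they do not mention derivatives. Being closed under limits of pairs \<open>(F, G)\<close>, they can be
transferred to a quadratic model.\<close>

definition strongly_convex_smooth ::
    "real \<Rightarrow> real \<Rightarrow> ('a::real_inner \<Rightarrow> real) \<Rightarrow> ('a \<Rightarrow> 'a) \<Rightarrow> bool" where
  "strongly_convex_smooth \<mu> L F G \<longleftrightarrow> (\<forall>y z.
     F y + G y \<bullet> (z - y) + \<mu> / 2 * (norm (z - y))\<^sup>2 \<le> F z \<and>
     F z \<le> F y + G y \<bullet> (z - y) + L / 2 * (norm (z - y))\<^sup>2)"

lemma strongly_convex_smooth_lower:
  "strongly_convex_smooth \<mu> L F G \<Longrightarrow> F y + G y \<bullet> (z - y) + \<mu> / 2 * (norm (z - y))\<^sup>2 \<le> F z"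
  by (simp add: strongly_convex_smooth_def)

lemma strongly_convex_smooth_upper:
  "strongly_convex_smooth \<mu> L F G \<Longrightarrow> F z \<le> F y + G y \<bullet> (z - y) + L / 2 * (norm (z - y))\<^sup>2"
  by (simp add: strongly_convex_smooth_def)

lemma strongly_convex_smooth_quadratic_growth:
  assumes "strongly_convex_smooth \<mu> L F G" "G x = 0"
  shows "F x + \<mu> / 2 * (norm (z - x))\<^sup>2 \<le> F z" "F z \<le> F x + L / 2 * (norm (z - x))\<^sup>2"
  using strongly_convex_smooth_lower[OF assms(1), of x z]
    strongly_convex_smooth_upper[OF assms(1), of z x] assms(2) by simp_all

lemma strongly_convex_smooth_monotone:
  assumes "strongly_convex_smooth \<mu> L F G"
  shows "\<mu> * (norm (y - z))\<^sup>2 \<le> (G y - G z) \<bullet> (y - z)"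
  using strongly_convex_smooth_lower[OF assms, of y z] strongly_convex_smooth_lower[OF assms, of z y]
  by (simp add: norm_minus_commute algebra_simps inner_diff_left inner_diff_right)

text \<open>For \<open>\<mu> > 0\<close> and \<open>z\<close> the minimizer, a small gradient at \<open>y\<close> forces \<open>y\<close> to be close to \<open>z\<close>.\<close>

lemma strongly_convex_smooth_gradient_bound:
  assumes "strongly_convex_smooth \<mu> L F G"
  shows "\<mu> * norm (y - z) \<le> norm (G y - G z)"
proof (cases "y = z")
  case False
  have "\<mu> * norm (y - z) * norm (y - z) \<le> norm (G y - G z) * norm (y - z)"
    using strongly_convex_smooth_monotone[OF assms, of y z] norm_cauchy_schwarz[of "G y - G z" "y - z"]
    by (simp add: power2_eq_square mult.assoc)
  with False show ?thesis by simp
qed simp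

lemma strongly_convex_smooth_shift:
  assumes "strongly_convex_smooth \<mu> L F G"
  shows "strongly_convex_smooth \<mu> L (\<lambda>z. F (z - e)) (\<lambda>z. G (z - e))"
  unfolding strongly_convex_smooth_def
proof (intro allI)
  fix y z
  have "z - e - (y - e) = z - y" by simp
  then show "F (y - e) + G (y - e) \<bullet> (z - y) + \<mu> / 2 * (norm (z - y))\<^sup>2 \<le> F (z - e) \<and>
     F (z - e) \<le> F (y - e) + G (y - e) \<bullet> (z - y) + L / 2 * (norm (z - y))\<^sup>2"
    using strongly_convex_smooth_lower[OF assms, of "y - e" "z - e"]
      strongly_convex_smooth_upper[OF assms, of "z - e" "y - e"] by metis
qed

lemma GDERIV_line:
  assumes "\<And>x. GDERIV F x :> G x"
  shows "((\<lambda>t. F (x + t *\<^sub>R v)) has_real_derivative G (x + t *\<^sub>R v) \<bullet> v) (at t)"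
proof -
  have "((\<lambda>t. F (x + t *\<^sub>R v)) has_derivative (\<lambda>h. (h *\<^sub>R v) \<bullet> G (x + t *\<^sub>R v))) (at t)"
    by (rule has_derivative_compose[OF _ assms[unfolded gderiv_def], simplified])
      (auto intro!: derivative_eq_intros)
  then show ?thesis
    by (simp add: has_field_derivative_def inner_commute mult_commute_abs)
qed

text \<open>The lower inequality is the limit \<open>t \<rightarrow> 0\<close> of the convexity inequality on the segment from \<open>y\<close> to \<open>z\<close>;
the upper one is the descent lemma.\<close>

lemma strongly_convex_smooth_if_Lipschitz_gradient:
  assumes grad: "\<And>x. GDERIV F x :> G x"
    and Lip: "L-lipschitz_on UNIV G"
    and sc: "strongly_convex F"
  obtains \<mu> where "\<mu> > 0" "strongly_convex_smooth \<mu> L F G"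
proof -
  from sc obtain \<mu> where "\<mu> > 0" and conv: "\<And>x y t. t \<in> {0..1} \<Longrightarrow>
      F ((1 - t) *\<^sub>R x + t *\<^sub>R y) \<le> (1 - t) * F x + t * F y - \<mu> / 2 * t * (1 - t) * (norm (x - y))\<^sup>2"
    unfolding strongly_convex_def by blast
  have lower: "F y + G y \<bullet> (z - y) + \<mu> / 2 * (norm (z - y))\<^sup>2 \<le> F z" for y z
  proof -
    let ?\<phi> = "\<lambda>t. F (y + t *\<^sub>R (z - y))"
    have "(?\<phi> has_real_derivative G y \<bullet> (z - y)) (at 0)"
      using GDERIV_line[OF grad, of y "z - y" 0] by simp
    then have "((\<lambda>t. (?\<phi> t - F y) / t) \<longlongrightarrow> G y \<bullet> (z - y)) (at_right 0)"
      by (auto simp: DERIV_def intro: tendsto_within_subset)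
    moreover have "((\<lambda>t. F z - F y - \<mu> / 2 * (1 - t) * (norm (z - y))\<^sup>2)
        \<longlongrightarrow> F z - F y - \<mu> / 2 * (1 - 0) * (norm (z - y))\<^sup>2) (at_right 0)"
      by (intro tendsto_intros)
    moreover have "\<forall>\<^sub>F t in at_right 0.
        (?\<phi> t - F y) / t \<le> F z - F y - \<mu> / 2 * (1 - t) * (norm (z - y))\<^sup>2"
    proof (rule eventually_at_rightI[of 0 1])
      fix t :: real assume t: "t \<in> {0<..<1}"
      have "(1 - t) *\<^sub>R y + t *\<^sub>R z = y + t *\<^sub>R (z - y)"
        by (simp add: algebra_simps)
      with conv[of t y z] t
      have "?\<phi> t - F y \<le> t * (F z - F y - \<mu> / 2 * (1 - t) * (norm (z - y))\<^sup>2)"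
        by (simp add: norm_minus_commute algebra_simps)
      with t show "(?\<phi> t - F y) / t \<le> F z - F y - \<mu> / 2 * (1 - t) * (norm (z - y))\<^sup>2"
        by (simp add: pos_divide_le_eq mult.commute)
    qed simp
    ultimately have "G y \<bullet> (z - y) \<le> F z - F y - \<mu> / 2 * (1 - 0) * (norm (z - y))\<^sup>2"
      by (intro tendsto_le[OF trivial_limit_at_right_real])
    then show ?thesis by simp
  qed
  have upper: "F z \<le> F y + G y \<bullet> (z - y) + L / 2 * (norm (z - y))\<^sup>2" for y z
  proof -
    let ?\<psi> = "\<lambda>t. F (y + t *\<^sub>R (z - y)) - t * (G y \<bullet> (z - y)) - L * t\<^sup>2 / 2 * (norm (z - y))\<^sup>2"
    \<comment> \<open>Along the segment, the Lipschitz bound makes the difference of the two sides nonincreasing.\<close>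
    have "?\<psi> 1 \<le> ?\<psi> 0"
    proof (rule DERIV_nonpos_imp_nonincreasing[where f = ?\<psi>])
      fix t :: real assume t: "0 \<le> t" "t \<le> 1"
      let ?w = "y + t *\<^sub>R (z - y)"
      have "(?\<psi> has_real_derivative
          G ?w \<bullet> (z - y) - G y \<bullet> (z - y) - L * t * (norm (z - y))\<^sup>2) (at t)"
        by (rule derivative_eq_intros GDERIV_line[OF grad] refl | simp)+
      moreover have "(G ?w - G y) \<bullet> (z - y) \<le> L * t * (norm (z - y))\<^sup>2"
      proof -
        have "norm (G ?w - G y) \<le> L * (t * norm (z - y))"
          using lipschitz_onD[OF Lip, of ?w y] t by (simp add: dist_norm)
        then have "norm (G ?w - G y) * norm (z - y) \<le> L * t * (norm (z - y))\<^sup>2"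
          using mult_right_mono[of _ _ "norm (z - y)"] by (fastforce simp: power2_eq_square mult.assoc)
        then show ?thesis
          using norm_cauchy_schwarz[of "G ?w - G y" "z - y"] by linarith
      qed
      ultimately show "\<exists>d. (?\<psi> has_real_derivative d) (at t) \<and> d \<le> 0"
        by (auto simp: inner_diff_left)
    qed simp
    then show ?thesis by simp
  qed
  show ?thesis
    using that[OF \<open>\<mu> > 0\<close>] lower upper by (simp add: strongly_convex_smooth_def)
qed

text \<open>The functions \<open>z \<mapsto> (F (x + t *\<^sub>R z) - F x) / t\<^sup>2\<close> with gradients \<open>z \<mapsto> G (x + t *\<^sub>R z) / t\<close> satisfy the same two
inequalities for every \<open>t > 0\<close>, and for \<open>t \<rightarrow> 0\<close> they converge to the quadratic and to \<open>H\<close>.\<close>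

lemma strongly_convex_smooth_linearization:
  assumes grad: "\<And>x. GDERIV F x :> G x"
    and scs: "strongly_convex_smooth \<mu> L F G"
    and crit: "G x = 0"
    and H: "(G has_derivative H) (at x)"
  shows "strongly_convex_smooth \<mu> L (\<lambda>z. 1 / 2 * (z \<bullet> H z)) H"
proof -
  have lin: "linear H"
    using H by (rule has_derivative_linear)
  have G_lim: "((\<lambda>t. (1 / t) *\<^sub>R G (x + t *\<^sub>R y)) \<longlongrightarrow> H y) (at_right 0)" for y
  proof -
    have "((\<lambda>t. G (x + t *\<^sub>R y)) has_derivative (\<lambda>t. H (t *\<^sub>R y))) (at 0)"
      by (rule has_derivative_compose[of "\<lambda>t. x + t *\<^sub>R y" "\<lambda>t. t *\<^sub>R y" 0 UNIV G H, simplified])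
        (auto intro!: derivative_eq_intros simp: H)
    then have "((\<lambda>t. (G (x + t *\<^sub>R y) - H (t *\<^sub>R y)) /\<^sub>R norm t) \<longlongrightarrow> 0) (at_right 0)"
      by (auto simp: has_derivative_at_within crit intro: tendsto_within_subset)
    moreover have "\<forall>\<^sub>F t in at_right 0. (G (x + t *\<^sub>R y) - H (t *\<^sub>R y)) /\<^sub>R norm t
        = (1 / t) *\<^sub>R G (x + t *\<^sub>R y) - H y"
      by (rule eventually_at_rightI[of 0 1])
        (simp_all add: linear_cmul[OF lin] scaleR_diff_right divide_inverse)
    ultimately have "((\<lambda>t. (1 / t) *\<^sub>R G (x + t *\<^sub>R y) - H y) \<longlongrightarrow> 0) (at_right 0)"
      by (rule Lim_transform_eventually)
    then show ?thesis
      by (rule LIM_zero_cancel)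
  qed
  have F_lim: "((\<lambda>t. (F (x + t *\<^sub>R z) - F x) / t\<^sup>2) \<longlongrightarrow> 1 / 2 * (z \<bullet> H z)) (at_right 0)" for z
  proof (rule lhopital_right)
    let ?\<phi> = "\<lambda>t. F (x + t *\<^sub>R z) - F x"
    have D: "(?\<phi> has_real_derivative G (x + t *\<^sub>R z) \<bullet> z) (at t)" for t
      by (rule derivative_eq_intros GDERIV_line[OF grad] refl | simp)+
    have "isCont ?\<phi> 0"
      using D DERIV_isCont by blast
    then show "(?\<phi> \<longlongrightarrow> 0) (at_right 0)"
      by (auto simp: isCont_def intro: tendsto_within_subset)
    show "\<forall>\<^sub>F t in at_right 0. (?\<phi> has_real_derivative G (x + t *\<^sub>R z) \<bullet> z) (at t)"
      using D by simp
    show "((\<lambda>t::real. t\<^sup>2) \<longlongrightarrow> 0) (at_right 0)"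
      by (rule tendsto_eq_intros refl | simp)+
    show "\<forall>\<^sub>F t::real in at_right 0. ((\<lambda>t. t\<^sup>2) has_real_derivative 2 * t) (at t)"
      by (auto intro!: always_eventually derivative_eq_intros)
    have "((\<lambda>t. 1 / 2 * (((1 / t) *\<^sub>R G (x + t *\<^sub>R z)) \<bullet> z)) \<longlongrightarrow> 1 / 2 * (H z \<bullet> z)) (at_right 0)"
      by (intro tendsto_intros G_lim)
    then show "((\<lambda>t. G (x + t *\<^sub>R z) \<bullet> z / (2 * t)) \<longlongrightarrow> 1 / 2 * (z \<bullet> H z)) (at_right 0)"
      by (simp add: inner_commute)
  qed (auto simp: eventually_at_filter)
  have "1 / 2 * (y \<bullet> H y) + H y \<bullet> (z - y) + \<mu> / 2 * (norm (z - y))\<^sup>2 \<le> 1 / 2 * (z \<bullet> H z) \<and>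
     1 / 2 * (z \<bullet> H z) \<le> 1 / 2 * (y \<bullet> H y) + H y \<bullet> (z - y) + L / 2 * (norm (z - y))\<^sup>2" for y z
  proof -
    let ?\<phi> = "\<lambda>z t. (F (x + t *\<^sub>R z) - F x) / t\<^sup>2"
    let ?A = "\<lambda>m t. ?\<phi> y t + ((1 / t) *\<^sub>R G (x + t *\<^sub>R y)) \<bullet> (z - y) + m / 2 * (norm (z - y))\<^sup>2"
    have A_lim: "(?A m \<longlongrightarrow> 1 / 2 * (y \<bullet> H y) + H y \<bullet> (z - y) + m / 2 * (norm (z - y))\<^sup>2) (at_right 0)" for m
      by (intro tendsto_intros F_lim G_lim)
    have scaled: "?A m t = (F (x + t *\<^sub>R y) + G (x + t *\<^sub>R y) \<bullet> ((x + t *\<^sub>R z) - (x + t *\<^sub>R y))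
         + m / 2 * (norm ((x + t *\<^sub>R z) - (x + t *\<^sub>R y)))\<^sup>2 - F x) / t\<^sup>2" if "t > 0" for m t
    proof -
      have "(x + t *\<^sub>R z) - (x + t *\<^sub>R y) = t *\<^sub>R (z - y)"
        by (simp add: algebra_simps)
      with that show ?thesis
        by (simp only: norm_scaleR inner_scaleR_right inner_scaleR_left power_mult_distrib power2_abs)
          (simp add: field_simps power2_eq_square)
    qed
    have "\<forall>\<^sub>F t in at_right 0. ?A \<mu> t \<le> ?\<phi> z t"
      by (rule eventually_at_rightI[of 0 1], simp_all only: scaled greaterThanLessThan_iff)
        (intro divide_right_mono diff_right_mono strongly_convex_smooth_lower[OF scs], simp_all)
    moreover have "\<forall>\<^sub>F t in at_right 0. ?\<phi> z t \<le> ?A L t"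
      by (rule eventually_at_rightI[of 0 1], simp_all only: scaled greaterThanLessThan_iff)
        (intro divide_right_mono diff_right_mono strongly_convex_smooth_upper[OF scs], simp_all)
    ultimately show ?thesis
      using tendsto_le[OF trivial_limit_at_right_real F_lim A_lim]
        tendsto_le[OF trivial_limit_at_right_real A_lim F_lim] by blast
  qed
  then show ?thesis
    by (simp add: strongly_convex_smooth_def)
qed

lemma strongly_convex_smooth_minimizer:
  fixes F :: "'a::euclidean_space \<Rightarrow> real"
  assumes scs: "strongly_convex_smooth \<mu> L F G" and "\<mu> > 0" "L > 0"
    and cont: "continuous_on UNIV F"
    and lb: "level_bounded F"
  shows "G (minimizer F) = 0"
proof -
  let ?S = "{z. F z \<le> F 0}"
  have "closed ?S"
    using continuous_closed_preimage[OF cont closed_UNIV closed_atMost[of "F 0"]]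
    by (simp add: vimage_def)
  then have "compact ?S"
    using lb by (auto simp: level_bounded_def compact_eq_bounded_closed)
  then obtain x where x: "x \<in> ?S" "\<And>z. z \<in> ?S \<Longrightarrow> F x \<le> F z"
    using continuous_attains_inf[of ?S F] continuous_on_subset[OF cont] by auto
  then have min: "F x \<le> F z" for z
    using x(2)[of z] x(2)[of 0] by fastforce
  have "G x = 0"
  proof -
    \<comment> \<open>A gradient step of length \<open>1 / L\<close> would decrease the value unless the gradient vanishes.\<close>
    have "F (x - (1 / L) *\<^sub>R G x) \<le> F x - (norm (G x))\<^sup>2 / (2 * L)"
      using strongly_convex_smooth_upper[OF scs, of "x - (1 / L) *\<^sub>R G x" x] \<open>L > 0\<close>
      by (simp add: power2_norm_eq_inner[symmetric] power_mult_distrib power2_eq_square field_simps)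
    with min[of "x - (1 / L) *\<^sub>R G x"] have "(norm (G x))\<^sup>2 / (2 * L) \<le> 0"
      by linarith
    with \<open>L > 0\<close> show ?thesis
      by (simp add: divide_le_0_iff)
  qed
  have "minimizer F = x"
    unfolding minimizer_def
  proof (rule the_equality)
    fix x' assume "\<forall>z. F x' \<le> F z"
    then have "\<mu> / 2 * (norm (x' - x))\<^sup>2 \<le> 0"
      using strongly_convex_smooth_quadratic_growth(1)[OF scs \<open>G x = 0\<close>, of x'] by (smt (verit))
    with \<open>\<mu> > 0\<close> show "x' = x"
      by (simp add: mult_le_0_iff)
  qed (use min in blast)
  with \<open>G x = 0\<close> show ?thesis by simp
qed

section \<open>The inertial method with inexact gradients\<close>

text \<open>The part of the error that is proportional to \<open>u k\<close> eventually uses up at most half of the contraction,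
and the remaining contraction averages out the other part.\<close>

lemma perturbed_contraction_tendsto_0:
  fixes u e :: "nat \<Rightarrow> real"
  assumes "0 < \<kappa>" "\<kappa> \<le> 1"
    and nonneg: "\<And>k. 0 \<le> u k"
    and e: "e \<longlonglongrightarrow> 0"
    and step: "\<forall>\<^sub>F k in sequentially. u (Suc k) \<le> (1 - \<kappa>) * u k + e k * (1 + u k)"
  shows "u \<longlonglongrightarrow> 0"
proof (rule order_tendstoI)
  fix \<alpha> :: real assume "0 < \<alpha>"
  \<comment> \<open>The first bound preserves the contraction factor \<open>1 - \<kappa> / 2\<close>, the second places the fixed point of
    the resulting affine recursion at \<open>\<alpha> / 2\<close>.\<close>
  define \<beta> where "\<beta> = min (\<kappa> / 2) (\<kappa> * \<alpha> / 4)"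
  have "0 < \<beta>"
    using \<open>0 < \<alpha>\<close> \<open>0 < \<kappa>\<close> by (simp add: \<beta>_def)
  with e have "\<forall>\<^sub>F k in sequentially. e k < \<beta>"
    by (rule order_tendstoD)
  with step have "\<forall>\<^sub>F k in sequentially. u (Suc k) \<le> (1 - \<kappa> / 2) * u k + \<kappa> * \<alpha> / 4"
  proof eventually_elim
    case (elim k)
    have "e k * (1 + u k) \<le> \<beta> * (1 + u k)"
      using elim nonneg[of k] by (intro mult_right_mono) auto
    also have "\<dots> \<le> \<kappa> * \<alpha> / 4 + \<kappa> / 2 * u k"
    proof -
      have "\<beta> \<le> \<kappa> * \<alpha> / 4" "\<beta> * u k \<le> \<kappa> / 2 * u k"
        using nonneg[of k] by (simp_all add: \<beta>_def mult_right_mono del: times_divide_eq_left)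
      then show ?thesis by (simp add: distrib_left)
    qed
    finally show ?case
      using elim by (simp add: algebra_simps)
  qed
  then obtain K where K: "\<And>k. k \<ge> K \<Longrightarrow> u (Suc k) \<le> (1 - \<kappa> / 2) * u k + \<kappa> * \<alpha> / 4"
    by (auto simp: eventually_sequentially)
  have decay: "u (K + n) \<le> (1 - \<kappa> / 2) ^ n * u K + \<alpha> / 2" for n
  proof (induction n)
    case (Suc n)
    have "u (K + Suc n) \<le> (1 - \<kappa> / 2) * u (K + n) + \<kappa> * \<alpha> / 4"
      using K[of "K + n"] by simp
    also have "\<dots> \<le> (1 - \<kappa> / 2) * ((1 - \<kappa> / 2) ^ n * u K + \<alpha> / 2) + \<kappa> * \<alpha> / 4"
      using Suc \<open>\<kappa> \<le> 1\<close> by (intro add_right_mono mult_left_mono) auto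
    also have "\<dots> = (1 - \<kappa> / 2) ^ Suc n * u K + \<alpha> / 2"
      by (simp add: algebra_simps)
    finally show ?case .
  qed (use \<open>0 < \<alpha>\<close> in simp)
  have "(\<lambda>n. (1 - \<kappa> / 2) ^ n * u K + \<alpha> / 2) \<longlonglongrightarrow> 0 * u K + \<alpha> / 2"
    using \<open>0 < \<kappa>\<close> \<open>\<kappa> \<le> 1\<close> by (intro tendsto_intros LIMSEQ_power_zero) auto
  then have "\<forall>\<^sub>F n in sequentially. (1 - \<kappa> / 2) ^ n * u K + \<alpha> / 2 < \<alpha>"
    by (rule order_tendstoD) (use \<open>0 < \<alpha>\<close> in simp)
  then have "\<forall>\<^sub>F n in sequentially. u (n + K) < \<alpha>"
  proof eventually_elim
    case (elim n)
    with decay[of n] show ?case by (simp add: add.commute)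
  qed
  then show "\<forall>\<^sub>F n in sequentially. u n < \<alpha>"
    using eventually_sequentially_seg[of "\<lambda>n. u n < \<alpha>" K] by simp
qed (use nonneg in \<open>auto intro: always_eventually order.strict_trans2\<close>)

text \<open>Both \<open>F (x + d')\<close> and \<open>F x\<close> are compared with the value at the extrapolated point \<open>x + b *\<^sub>R d\<close>, the first by
the upper and the second by the lower inequality. The gradient is then eliminated through the update
rule, which leaves a quadratic form in \<open>d\<close> and \<open>d'\<close>; its mixed term is split evenly.\<close>

lemma inertial_step_descent:
  fixes x d d' :: "'a::real_inner"
  assumes scs: "strongly_convex_smooth \<mu> L F G" and "\<mu> > 0" "\<gamma> > 0"
    and d': "d' = a *\<^sub>R d - \<gamma> *\<^sub>R (G (x + b *\<^sub>R d) + r)"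
    and s: "s = \<gamma> * L / 2"
  shows "\<gamma> * (F (x + d') - F x) \<le>
      - (1 - s - \<bar>a - 2 * s * b\<bar> / 2) * (norm d')\<^sup>2 + (s * b\<^sup>2 + \<bar>a - 2 * s * b\<bar> / 2) * (norm d)\<^sup>2
      + \<gamma> * (norm r * norm d')"
proof -
  define y where "y = x + b *\<^sub>R d"
  have "F (x + d') \<le> F y + G y \<bullet> (d' - b *\<^sub>R d) + L / 2 * (norm (d' - b *\<^sub>R d))\<^sup>2"
    using strongly_convex_smooth_upper[OF scs, of "x + d'" y] by (simp add: y_def)
  moreover have "F y + G y \<bullet> (- (b *\<^sub>R d)) \<le> F x"
    using strongly_convex_smooth_lower[OF scs, of y x] \<open>\<mu> > 0\<close>
    by (simp add: y_def) (smt (verit) mult_nonneg_nonneg zero_le_power2 divide_nonneg_nonneg)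
  ultimately have "F (x + d') - F x \<le> G y \<bullet> d' + L / 2 * (norm (d' - b *\<^sub>R d))\<^sup>2"
    by (simp add: inner_diff_right)
  then have "\<gamma> * (F (x + d') - F x) \<le> \<gamma> * (G y \<bullet> d' + L / 2 * (norm (d' - b *\<^sub>R d))\<^sup>2)"
    using \<open>\<gamma> > 0\<close> by simp
  also have "\<dots> = (\<gamma> *\<^sub>R G y) \<bullet> d' + s * (norm (d' - b *\<^sub>R d))\<^sup>2"
    by (simp add: s algebra_simps)
  also have "\<gamma> *\<^sub>R G y = a *\<^sub>R d - d' - \<gamma> *\<^sub>R r"
    by (simp add: d' y_def algebra_simps)
  also have "(a *\<^sub>R d - d' - \<gamma> *\<^sub>R r) \<bullet> d' + s * (norm (d' - b *\<^sub>R d))\<^sup>2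
      = - (1 - s) * (norm d')\<^sup>2 + (a - 2 * s * b) * (d \<bullet> d') + s * b\<^sup>2 * (norm d)\<^sup>2
        + (- (\<gamma> * (r \<bullet> d')))"
    unfolding power2_norm_eq_inner
    by (simp add: inner_diff_left inner_diff_right inner_commute algebra_simps power2_eq_square)
  also have "(a - 2 * s * b) * (d \<bullet> d') \<le> \<bar>a - 2 * s * b\<bar> * (((norm d)\<^sup>2 + (norm d')\<^sup>2) / 2)"
  proof -
    have "(a - 2 * s * b) * (d \<bullet> d') \<le> \<bar>a - 2 * s * b\<bar> * \<bar>d \<bullet> d'\<bar>"
      by (metis abs_ge_self abs_mult)
    also have "\<bar>d \<bullet> d'\<bar> \<le> ((norm d)\<^sup>2 + (norm d')\<^sup>2) / 2"
      using Cauchy_Schwarz_ineq2[of d d'] sum_squares_bound[of "norm d" "norm d'"] by (simp add: field_simps)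
    finally show ?thesis
      by (simp add: mult_left_mono)
  qed
  also have "- (\<gamma> * (r \<bullet> d')) \<le> \<gamma> * (norm r * norm d')"
    using Cauchy_Schwarz_ineq2[of r d'] \<open>\<gamma> > 0\<close> mult_left_mono[of "- (r \<bullet> d')" "norm r * norm d'" \<gamma>]
    by simp
  finally show ?thesis
    by (simp add: algebra_simps add_divide_distrib)
qed

text \<open>The momentum form, with \<open>d k\<close> in place of the difference of two successive iterates, avoids an iterate
with index \<open>- 1\<close>.\<close>

theorem inexact_inertial_method_converges:
  fixes x d r :: "nat \<Rightarrow> 'a::real_inner" and F :: "'a \<Rightarrow> real"
  assumes scs: "strongly_convex_smooth \<mu> L F G" and \<mu>: "\<mu> > 0" and L: "L > 0"
    and crit: "G xs = 0"
    and a: "\<And>k. a k \<in> {0..1}" and b: "\<And>k. b k \<in> {0..1}" and g: "\<And>k. 0 < \<gamma> k"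
    and margin: "0 < \<tau>" "\<And>k. s k = \<gamma> k * L / 2"
      "\<And>k. \<tau> < 1 - s k - \<bar>a k - 2 * s k * b k\<bar> - s k * (b k)\<^sup>2"
    and lims: "a \<longlonglongrightarrow> a'" "b \<longlonglongrightarrow> b'" "\<gamma> \<longlonglongrightarrow> \<gamma>'" "0 < \<gamma>'"
    and x: "\<And>k. x (Suc k) = x k + d (Suc k)"
    and y: "\<And>k. y k = x k + b k *\<^sub>R d k"
    and d: "\<And>k. d (Suc k) = a k *\<^sub>R d k - \<gamma> k *\<^sub>R (G (y k) + r k)"
    and r: "\<And>k. norm (r k) \<le> \<epsilon> k * (1 + norm (y k - xs))"
    and \<epsilon>: "\<epsilon> \<longlonglongrightarrow> 0"
  shows "x \<longlonglongrightarrow> xs"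
proof -
  define s' where "s' = \<gamma>' * L / 2"
  define p where "p k = 1 - s k - \<bar>a k - 2 * s k * b k\<bar> / 2" for k
  define q where "q k = s k * (b k)\<^sup>2 + \<bar>a k - 2 * s k * b k\<bar> / 2" for k
  define p' where "p' = 1 - s' - \<bar>a' - 2 * s' * b'\<bar> / 2"
  define q' where "q' = s' * b'\<^sup>2 + \<bar>a' - 2 * s' * b'\<bar> / 2"
  have s_lim: "s \<longlonglongrightarrow> s'"
    unfolding margin(2) s'_def by (intro tendsto_intros lims) simp
  have p_lim: "p \<longlonglongrightarrow> p'" and q_lim: "q \<longlonglongrightarrow> q'"
    unfolding p_def[abs_def] q_def[abs_def] p'_def q'_def
    by (auto intro!: tendsto_intros lims s_lim)
  have pq: "p' - q' \<ge> \<tau>"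
  proof (rule tendsto_lowerbound)
    show "(\<lambda>k. p k - q k) \<longlonglongrightarrow> p' - q'"
      by (intro tendsto_intros p_lim q_lim)
    show "\<forall>\<^sub>F k in sequentially. \<tau> \<le> p k - q k"
    proof (intro always_eventually allI)
      fix k
      show "\<tau> \<le> p k - q k"
        using margin(3)[of k] by (simp add: p_def q_def)
    qed
  qed simp
  have "s' \<ge> 0"
    using \<open>0 < \<gamma>'\<close> L by (simp add: s'_def)
  then have "q' \<ge> 0"
    by (simp add: q'_def)
  \<comment> \<open>The weight of the squared step lies halfway between the limits of the two coefficients in
    the descent estimate, so that both leave the same slack.\<close>
  define c where "c = (p' + q') / (2 * \<gamma>')"
  define \<delta> where "\<delta> = \<tau> / (4 * \<gamma>')"
  have "\<delta> > 0"
    using \<open>\<tau> > 0\<close> \<open>\<gamma>' > 0\<close> by (simp add: \<delta>_def)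
  have "c > 0"
    using pq \<open>q' \<ge> 0\<close> \<open>\<tau> > 0\<close> \<open>\<gamma>' > 0\<close> by (simp add: c_def)
  have "c + \<delta> < p' / \<gamma>'" "q' / \<gamma>' < c - \<delta>"
  proof -
    have "p' / \<gamma>' - (c + \<delta>) = (2 * (p' - q') - \<tau>) / (4 * \<gamma>')"
      "(c - \<delta>) - q' / \<gamma>' = (2 * (p' - q') - \<tau>) / (4 * \<gamma>')"
      using \<open>\<gamma>' > 0\<close> by (simp_all add: c_def \<delta>_def field_simps)
    moreover have "(2 * (p' - q') - \<tau>) / (4 * \<gamma>') > 0"
      using pq \<open>\<tau> > 0\<close> \<open>\<gamma>' > 0\<close> by simp
    ultimately show "c + \<delta> < p' / \<gamma>'" "q' / \<gamma>' < c - \<delta>"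
      by linarith+
  qed
  moreover have "(\<lambda>k. p k / \<gamma> k) \<longlonglongrightarrow> p' / \<gamma>'" "(\<lambda>k. q k / \<gamma> k) \<longlonglongrightarrow> q' / \<gamma>'"
    using \<open>\<gamma>' > 0\<close> by (intro tendsto_intros p_lim q_lim lims; simp)+
  ultimately have ev_p: "\<forall>\<^sub>F k in sequentially. c + \<delta> < p k / \<gamma> k"
    and ev_q: "\<forall>\<^sub>F k in sequentially. q k / \<gamma> k < c - \<delta>"
    by (auto intro: order_tendstoD)
  have ev_\<gamma>: "\<forall>\<^sub>F k in sequentially. \<gamma>' / 2 < \<gamma> k"
    using lims(3) by (rule order_tendstoD) (use \<open>0 < \<gamma>'\<close> in simp)

  define E where "E k = F (x k) - F xs + c * (norm (d k))\<^sup>2" for k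
  note growth = strongly_convex_smooth_quadratic_growth[OF scs crit]
  have E_lower: "\<mu> / 2 * (norm (x k - xs))\<^sup>2 + c * (norm (d k))\<^sup>2 \<le> E k" for k
    using growth(1)[of "x k"] by (simp add: E_def)
  have E_upper: "E k \<le> L / 2 * (norm (x k - xs))\<^sup>2 + c * (norm (d k))\<^sup>2" for k
    using growth(2)[of "x k"] by (simp add: E_def)
  have E_nonneg: "0 \<le> E k" for k
    using E_lower[of k] \<mu> \<open>c > 0\<close> by (smt (verit) mult_nonneg_nonneg zero_le_power2 divide_nonneg_nonneg)

  \<comment> \<open>The energy loses a multiple of the squared steps.\<close>
  have descent: "\<forall>\<^sub>F k in sequentially. E (Suc k) \<le> E k
      - \<delta> / 2 * ((norm (d k))\<^sup>2 + (norm (d (Suc k)))\<^sup>2) + (norm (r k))\<^sup>2 / (2 * \<delta>)"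
    using ev_p ev_q
  proof eventually_elim
    case (elim k)
    have "\<gamma> k * (F (x (Suc k)) - F (x k)) \<le>
        - p k * (norm (d (Suc k)))\<^sup>2 + q k * (norm (d k))\<^sup>2 + \<gamma> k * (norm (r k) * norm (d (Suc k)))"
      unfolding x p_def q_def
      by (rule inertial_step_descent[OF scs \<mu> g d[unfolded y] margin(2)])
    then have "F (x (Suc k)) - F (x k) \<le>
        - (p k / \<gamma> k) * (norm (d (Suc k)))\<^sup>2 + (q k / \<gamma> k) * (norm (d k))\<^sup>2 + norm (r k) * norm (d (Suc k))"
      using g[of k] by (simp add: field_simps)
    also have "- (p k / \<gamma> k) * (norm (d (Suc k)))\<^sup>2 \<le> - (c + \<delta>) * (norm (d (Suc k)))\<^sup>2"
      using elim by (intro mult_right_mono) auto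
    also have "q k / \<gamma> k * (norm (d k))\<^sup>2 \<le> (c - \<delta>) * (norm (d k))\<^sup>2"
      using elim by (intro mult_right_mono) auto
    also have "norm (r k) * norm (d (Suc k)) \<le> \<delta> / 2 * (norm (d (Suc k)))\<^sup>2 + (norm (r k))\<^sup>2 / (2 * \<delta>)"
    proof -
      have "0 \<le> (\<delta> * norm (d (Suc k)) - norm (r k))\<^sup>2 / (2 * \<delta>)"
        using \<open>\<delta> > 0\<close> by simp
      also have "\<dots> = \<delta> / 2 * (norm (d (Suc k)))\<^sup>2 + (norm (r k))\<^sup>2 / (2 * \<delta>) - norm (r k) * norm (d (Suc k))"
        using \<open>\<delta> > 0\<close> by (simp add: power2_eq_square field_simps)
      finally show ?thesis by simp
    qed
    finally have "E (Suc k) \<le> E k - \<delta> / 2 * (norm (d (Suc k)))\<^sup>2 - \<delta> * (norm (d k))\<^sup>2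
        + (norm (r k))\<^sup>2 / (2 * \<delta>)"
      by (simp add: E_def algebra_simps)
    moreover have "\<delta> / 2 * (norm (d k))\<^sup>2 \<le> \<delta> * (norm (d k))\<^sup>2"
      using \<open>\<delta> > 0\<close> by simp
    ultimately show ?case
      by (simp add: algebra_simps)
  qed

  \<comment> \<open>Conversely, the energy is controlled by the steps: a small step means a small gradient, and
    by strong convexity a point close to the minimizer.\<close>
  define C where "C = 2 / (\<gamma>' * \<mu>) + 1 / \<mu> + 1"
  define C1 where "C1 = 3 / 2 * L * C\<^sup>2 + c + \<delta>"
  have "C > 0"
    unfolding C_def using \<mu> \<open>\<gamma>' > 0\<close> by (intro add_pos_pos) auto
  have C1: "C1 > 0" "C1 \<ge> \<delta>"
    using L \<open>c > 0\<close> \<open>\<delta> > 0\<close> by (simp_all add: C1_def add_nonneg_pos)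
  have control: "\<forall>\<^sub>F k in sequentially.
      E k \<le> C1 * ((norm (d k))\<^sup>2 + (norm (d (Suc k)))\<^sup>2 + (norm (r k))\<^sup>2)"
    using ev_\<gamma>
  proof eventually_elim
    case (elim k)
    have "norm (a k *\<^sub>R d k - d (Suc k)) \<le> norm (d k) + norm (d (Suc k))"
    proof -
      have "norm (a k *\<^sub>R d k) \<le> norm (d k)"
        using a[of k] by (simp add: mult_left_le_one_le)
      then show ?thesis
        using norm_triangle_ineq4[of "a k *\<^sub>R d k" "d (Suc k)"] by linarith
    qed
    moreover have "1 / \<gamma> k \<le> 2 / \<gamma>'"
      using elim \<open>\<gamma>' > 0\<close> by (simp add: field_simps)
    ultimately have "1 / \<gamma> k * norm (a k *\<^sub>R d k - d (Suc k)) \<le> 2 / \<gamma>' * (norm (d k) + norm (d (Suc k)))"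
      using \<open>\<gamma>' > 0\<close> by (intro mult_mono) auto
    moreover have "G (y k) = (1 / \<gamma> k) *\<^sub>R (a k *\<^sub>R d k - d (Suc k)) - r k"
      using g[of k] by (simp add: d algebra_simps)
    then have "norm (G (y k)) \<le> 1 / \<gamma> k * norm (a k *\<^sub>R d k - d (Suc k)) + norm (r k)"
      using norm_triangle_ineq4[of "(1 / \<gamma> k) *\<^sub>R (a k *\<^sub>R d k - d (Suc k))" "r k"] g[of k] by simp
    ultimately have "\<mu> * norm (y k - xs) \<le> 2 / \<gamma>' * (norm (d k) + norm (d (Suc k))) + norm (r k)"
      using strongly_convex_smooth_gradient_bound[OF scs, of "y k" xs] crit by simp
    then have "norm (y k - xs) \<le> 2 / (\<gamma>' * \<mu>) * (norm (d k) + norm (d (Suc k))) + 1 / \<mu> * norm (r k)"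
      using \<mu> \<open>\<gamma>' > 0\<close> by (simp add: field_simps)
    moreover have "norm (x k - xs) \<le> norm (y k - xs) + norm (d k)"
    proof -
      have "norm (b k *\<^sub>R d k) \<le> norm (d k)"
        using b[of k] by (simp add: mult_left_le_one_le)
      then show ?thesis
        using norm_triangle_ineq4[of "y k - xs" "b k *\<^sub>R d k"] by (simp add: y)
    qed
    moreover have "2 / (\<gamma>' * \<mu>) * (norm (d k) + norm (d (Suc k))) + 1 / \<mu> * norm (r k) + norm (d k)
        \<le> C * (norm (d k) + norm (d (Suc k)) + norm (r k))"
      using \<mu> \<open>\<gamma>' > 0\<close> by (simp add: C_def distrib_left distrib_right)
    ultimately have "norm (x k - xs) \<le> C * (norm (d k) + norm (d (Suc k)) + norm (r k))"
      by linarith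
    then have "(norm (x k - xs))\<^sup>2 \<le> (C * (norm (d k) + norm (d (Suc k)) + norm (r k)))\<^sup>2"
      by (rule power_mono) simp
    also have "\<dots> = C\<^sup>2 * (norm (d k) + norm (d (Suc k)) + norm (r k))\<^sup>2"
      by (simp add: power_mult_distrib)
    also have "\<dots> \<le> C\<^sup>2 * (3 * ((norm (d k))\<^sup>2 + (norm (d (Suc k)))\<^sup>2 + (norm (r k))\<^sup>2))"
    proof (rule mult_left_mono)
      have "(t + u + v)\<^sup>2 \<le> 3 * (t\<^sup>2 + u\<^sup>2 + v\<^sup>2)" for t u v :: real
        using sum_squares_bound[of t u] sum_squares_bound[of u v] sum_squares_bound[of t v]
        by (simp add: power2_eq_square algebra_simps)
      then show "(norm (d k) + norm (d (Suc k)) + norm (r k))\<^sup>2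
          \<le> 3 * ((norm (d k))\<^sup>2 + (norm (d (Suc k)))\<^sup>2 + (norm (r k))\<^sup>2)" .
    qed simp
    finally have "L / 2 * (norm (x k - xs))\<^sup>2
        \<le> L / 2 * (C\<^sup>2 * (3 * ((norm (d k))\<^sup>2 + (norm (d (Suc k)))\<^sup>2 + (norm (r k))\<^sup>2)))"
      using L by (intro mult_left_mono) auto
    moreover have "c * (norm (d k))\<^sup>2 \<le> (c + \<delta>) * ((norm (d k))\<^sup>2 + (norm (d (Suc k)))\<^sup>2 + (norm (r k))\<^sup>2)"
      using \<open>c > 0\<close> \<open>\<delta> > 0\<close> by (intro mult_mono) auto
    ultimately show ?case
      using E_upper[of k] by (simp add: C1_def algebra_simps)
  qed

  \<comment> \<open>The energy dominates the squared distance of the extrapolated point from the minimizer, so the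
    squared error is small relative to one plus the energy.\<close>
  define C2 where "C2 = 2 * (2 / \<mu> + 1 / c)"
  define C3 where "C3 = \<delta> / 2 + 1 / (2 * \<delta>)"
  have "C2 > 0" "C3 > 0"
    unfolding C2_def C3_def using \<mu> \<open>c > 0\<close> \<open>\<delta> > 0\<close> by (simp_all add: add_pos_pos)
  have r_bound: "(norm (r k))\<^sup>2 \<le> 2 * (\<epsilon> k)\<^sup>2 * (1 + C2) * (1 + E k)" for k
  proof -
    define w where "w = norm (y k - xs)"
    have "(norm (r k))\<^sup>2 \<le> (\<epsilon> k * (1 + w))\<^sup>2"
      using r[of k] unfolding w_def by (rule power_mono) simp
    also have "\<dots> = (\<epsilon> k)\<^sup>2 * (1 + w)\<^sup>2"
      by (simp add: power_mult_distrib)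
    also have "(1 + w)\<^sup>2 \<le> 2 * (1 + w\<^sup>2)"
      using sum_squares_bound[of 1 w] by (simp add: power2_eq_square algebra_simps)
    also have "w\<^sup>2 \<le> C2 * E k"
    proof -
      have "norm (b k *\<^sub>R d k) \<le> norm (d k)"
        using b[of k] by (simp add: mult_left_le_one_le)
      then have "w \<le> norm (x k - xs) + norm (d k)"
        using norm_triangle_ineq[of "x k - xs" "b k *\<^sub>R d k"] by (simp add: y w_def algebra_simps)
      then have "w\<^sup>2 \<le> (norm (x k - xs) + norm (d k))\<^sup>2"
        by (rule power_mono) (simp add: w_def)
      also have "\<dots> \<le> 2 * ((norm (x k - xs))\<^sup>2 + (norm (d k))\<^sup>2)"
        using sum_squares_bound[of "norm (x k - xs)" "norm (d k)"]
        by (simp add: power2_eq_square algebra_simps)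
      also have "(norm (x k - xs))\<^sup>2 \<le> 2 / \<mu> * E k"
      proof -
        have "\<mu> / 2 * (norm (x k - xs))\<^sup>2 \<le> E k"
          using E_lower[of k] \<open>c > 0\<close> by (smt (verit) mult_nonneg_nonneg zero_le_power2)
        with \<mu> show ?thesis by (simp add: field_simps)
      qed
      also have "(norm (d k))\<^sup>2 \<le> 1 / c * E k"
      proof -
        have "c * (norm (d k))\<^sup>2 \<le> E k"
          using E_lower[of k] \<mu> by (smt (verit) mult_nonneg_nonneg zero_le_power2 divide_nonneg_nonneg)
        with \<open>c > 0\<close> show ?thesis by (simp add: field_simps)
      qed
      finally show ?thesis
        by (simp add: C2_def algebra_simps)
    qed
    also have "1 + C2 * E k \<le> (1 + C2) * (1 + E k)"
      using \<open>C2 > 0\<close> E_nonneg[of k] by (simp add: algebra_simps)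
    finally have "(norm (r k))\<^sup>2 \<le> (\<epsilon> k)\<^sup>2 * (2 * ((1 + C2) * (1 + E k)))"
      by (simp add: mult_left_mono)
    then show ?thesis
      by (simp only: mult_ac)
  qed

  have "E \<longlonglongrightarrow> 0"
  proof (rule perturbed_contraction_tendsto_0)
    show "0 < \<delta> / (2 * C1)" "\<delta> / (2 * C1) \<le> 1"
      using \<open>\<delta> > 0\<close> C1 by simp_all
    have "(\<lambda>k. 2 * C3 * (1 + C2) * (\<epsilon> k)\<^sup>2) \<longlonglongrightarrow> 2 * C3 * (1 + C2) * 0\<^sup>2"
      by (intro tendsto_intros \<epsilon>)
    then show "(\<lambda>k. 2 * C3 * (1 + C2) * (\<epsilon> k)\<^sup>2) \<longlonglongrightarrow> 0"
      by simp
    show "\<forall>\<^sub>F k in sequentially.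
        E (Suc k) \<le> (1 - \<delta> / (2 * C1)) * E k + 2 * C3 * (1 + C2) * (\<epsilon> k)\<^sup>2 * (1 + E k)"
      using descent control
    proof eventually_elim
      case (elim k)
      have "\<delta> / (2 * C1) * E k \<le> \<delta> / 2 * ((norm (d k))\<^sup>2 + (norm (d (Suc k)))\<^sup>2 + (norm (r k))\<^sup>2)"
        using mult_left_mono[OF elim(2), of "\<delta> / (2 * C1)"] C1 \<open>\<delta> > 0\<close> by simp
      then have "E (Suc k) \<le> (1 - \<delta> / (2 * C1)) * E k + C3 * (norm (r k))\<^sup>2"
        using elim(1) by (simp add: C3_def algebra_simps)
      also have "C3 * (norm (r k))\<^sup>2 \<le> C3 * (2 * (\<epsilon> k)\<^sup>2 * (1 + C2) * (1 + E k))"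
        using r_bound[of k] \<open>C3 > 0\<close> by (simp add: mult_left_mono)
      finally show ?case
        by (simp only: mult_ac)
    qed
  qed (rule E_nonneg)
  then have "(\<lambda>k. sqrt (2 / \<mu> * E k)) \<longlonglongrightarrow> sqrt (2 / \<mu> * 0)"
    by (intro tendsto_real_sqrt tendsto_mult tendsto_const)
  then have sqrt_lim: "(\<lambda>k. sqrt (2 / \<mu> * E k)) \<longlonglongrightarrow> 0"
    by simp
  have sqrt_bound: "norm (x k - xs) \<le> sqrt (2 / \<mu> * E k)" for k
  proof (rule real_le_rsqrt)
    have "0 \<le> c * (norm (d k))\<^sup>2"
      using \<open>c > 0\<close> by simp
    then have "\<mu> / 2 * (norm (x k - xs))\<^sup>2 \<le> E k"
      using E_lower[of k] by linarith
    with \<mu> show "(norm (x k - xs))\<^sup>2 \<le> 2 / \<mu> * E k"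
      by (simp add: field_simps)
  qed
  have "(\<lambda>k. x k - xs) \<longlonglongrightarrow> 0"
    by (rule Lim_null_comparison[OF always_eventually[OF allI[OF sqrt_bound]] sqrt_lim])
  then show ?thesis
    by (rule LIM_zero_cancel)
qed

text \<open>With \<open>s = \<gamma> * L / 2 < 1\<close>, the margin equals \<open>1 + a - s * (1 + b)\<^sup>2\<close> if \<open>a \<le> 2 * s * b\<close> and
\<open>1 - a - s * (1 - b)\<^sup>2\<close> otherwise. The first alternative of the condition has \<open>a < s * b\<close> and is literally
the first case. The second alternative implies \<open>s * b \<le> a\<close>, and then its bound on
\<open>1 - 3 * a - s * (1 - b)\<^sup>2\<close> covers both cases.\<close>

lemma param_condition_margin:
  assumes B: "param_condition L a b \<gamma>" and L: "L > 0"
    and a: "\<And>k. a k \<in> {0..1}" and b: "\<And>k. b k \<in> {0..1}"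
    and \<gamma>: "\<And>k. 0 < \<gamma> k" "\<And>k. \<gamma> k < 2 / L"
  obtains \<tau> where "0 < \<tau>" "\<And>k. \<tau> < 1 - \<gamma> k * L / 2 - \<bar>a k - 2 * (\<gamma> k * L / 2) * b k\<bar> - \<gamma> k * L / 2 * (b k)\<^sup>2"
proof -
  define s where "s k = \<gamma> k * L / 2" for k
  have s: "0 < s k" "s k < 1" for k
    using \<gamma>[of k] L by (simp_all add: s_def field_simps)
  obtain \<tau> where "\<tau> > 0" and \<tau>:
    "(\<forall>k. \<tau> < (1 + a k) - s k * (1 + b k)\<^sup>2 \<and> a k < s k * b k) \<or>
     (\<forall>k. \<tau> < (1 - 3 * a k) - s k * (1 - b k)\<^sup>2 \<and> (b k \<le> a k \<or> s k * b k \<le> a k \<and> a k < b k))"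
    using B unfolding param_condition_def s_def by blast
  have "\<tau> < 1 - s k - \<bar>a k - 2 * s k * b k\<bar> - s k * (b k)\<^sup>2" for k
  proof -
    have sb: "0 \<le> s k * b k" "s k * b k \<le> b k"
      using s[of k] b[of k] by (auto simp: mult_left_le_one_le)
    from \<tau> consider "\<tau> < (1 + a k) - s k * (1 + b k)\<^sup>2" "a k < s k * b k"
      | "\<tau> < (1 - 3 * a k) - s k * (1 - b k)\<^sup>2" "s k * b k \<le> a k"
    proof (elim disjE)
      assume "\<forall>k. \<tau> < (1 + a k) - s k * (1 + b k)\<^sup>2 \<and> a k < s k * b k"
      with that(1) show ?thesis by simp
    next
      assume "\<forall>k. \<tau> < (1 - 3 * a k) - s k * (1 - b k)\<^sup>2 \<and> (b k \<le> a k \<or> s k * b k \<le> a k \<and> a k < b k)"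
      then have "\<tau> < (1 - 3 * a k) - s k * (1 - b k)\<^sup>2" "b k \<le> a k \<or> s k * b k \<le> a k"
        by blast+
      with that(2) sb(2) show ?thesis by linarith
    qed
    then show ?thesis
    proof cases
      case 1
      then have "\<bar>a k - 2 * s k * b k\<bar> = 2 * (s k * b k) - a k"
        using sb by auto
      with 1 show ?thesis
        by (simp add: power2_eq_square algebra_simps)
    next
      case 2
      have "\<tau> < 1 - 3 * a k - s k + 2 * (s k * b k) - s k * (b k)\<^sup>2"
        using 2(1) by (simp add: power2_eq_square algebra_simps)
      then show ?thesis
        using 2(2) sb a[of k] by (simp add: abs_if)
    qed
  qed
  with \<open>\<tau> > 0\<close> show ?thesis
    using that by (simp add: s_def)
qed

lemma inertial_pair_Suc:
  fixes f :: "'x::real_inner \<Rightarrow> 't \<Rightarrow> real" and a b \<gamma> :: "nat \<Rightarrow> real" and x0 :: "'t \<Rightarrow> 'x" and \<theta> :: 't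
  defines "p \<equiv> inertial_pair f a b \<gamma> x0 \<theta>"
  shows "fst (p (Suc k)) = fst (p k) + a k *\<^sub>R (fst (p k) - snd (p k))
      - \<gamma> k *\<^sub>R gradient (\<lambda>z. f z \<theta>) (fst (p k) + b k *\<^sub>R (fst (p k) - snd (p k)))"
    and "snd (p (Suc k)) = fst (p k)"
  unfolding p_def by (simp_all only: inertial_pair.simps Let_def case_prod_beta fst_conv snd_conv)

lemma inertial_pair_tendsto:
  fixes f :: "'x::real_inner \<Rightarrow> 't \<Rightarrow> real"
  assumes scs: "strongly_convex_smooth \<mu> L (\<lambda>z. f z \<theta>) (gradient (\<lambda>z. f z \<theta>))"
    and "\<mu> > 0" "L > 0"
    and crit: "gradient (\<lambda>z. f z \<theta>) xs = 0"
    and a: "\<And>k. a k \<in> {0..1}" and b: "\<And>k. b k \<in> {0..1}" and g: "\<And>k. 0 < \<gamma> k"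
    and margin: "0 < \<tau>" "\<And>k. \<tau> < 1 - \<gamma> k * L / 2 - \<bar>a k - 2 * (\<gamma> k * L / 2) * b k\<bar> - \<gamma> k * L / 2 * (b k)\<^sup>2"
    and lims: "a \<longlonglongrightarrow> a'" "b \<longlonglongrightarrow> b'" "\<gamma> \<longlonglongrightarrow> \<gamma>'" "0 < \<gamma>'"
  shows "(\<lambda>k. inertial_pair f a b \<gamma> x0 \<theta> k) \<longlonglongrightarrow> (xs, xs)"
proof -
  let ?p = "inertial_pair f a b \<gamma> x0 \<theta>"
  have "(\<lambda>k. fst (?p k)) \<longlonglongrightarrow> xs"
  proof (rule inexact_inertial_method_converges[OF scs \<open>\<mu> > 0\<close> \<open>L > 0\<close> crit a b g margin(1) refl margin(2) lims])
    show "fst (?p (Suc k)) = fst (?p k) + (fst (?p (Suc k)) - snd (?p (Suc k)))" for k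
      by (simp add: inertial_pair_Suc del: inertial_pair.simps)
    show "fst (?p (Suc k)) - snd (?p (Suc k)) = a k *\<^sub>R (fst (?p k) - snd (?p k))
        - \<gamma> k *\<^sub>R (gradient (\<lambda>z. f z \<theta>) (fst (?p k) + b k *\<^sub>R (fst (?p k) - snd (?p k))) + 0)" for k
      by (simp add: inertial_pair_Suc del: inertial_pair.simps)
    show "norm (0 :: 'x) \<le> 0 * (1 + norm (fst (?p k) + b k *\<^sub>R (fst (?p k) - snd (?p k)) - xs))" for k
      by simp
  qed (rule refl tendsto_const)+
  moreover have "(\<lambda>k. snd (?p k)) \<longlonglongrightarrow> xs"
  proof (rule LIMSEQ_imp_Suc)
    show "(\<lambda>k. snd (?p (Suc k))) \<longlonglongrightarrow> xs"
      using calculation by (simp only: inertial_pair_Suc)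
  qed
  ultimately show ?thesis
    using tendsto_Pair[of "\<lambda>k. fst (?p k)" xs sequentially "\<lambda>k. snd (?p k)" xs] by simp
qed

section \<open>Differentiation with respect to the parameter\<close>

lemma C2_on_partial_gradient:
  fixes f :: "'x::euclidean_space \<Rightarrow> 't::real_normed_vector \<Rightarrow> real"
  assumes "open \<Theta>" and C2: "C2_on (UNIV \<times> \<Theta>) (\<lambda>(x, \<theta>). f x \<theta>)"
  shows "\<And>x \<theta>. \<theta> \<in> \<Theta> \<Longrightarrow> GDERIV (\<lambda>z. f z \<theta>) x :> gradient (\<lambda>z. f z \<theta>) x"
    and "C1_on (UNIV \<times> \<Theta>) (\<lambda>(x, \<theta>). gradient (\<lambda>z. f z \<theta>) x)"
proof -
  let ?S = "UNIV \<times> \<Theta> :: ('x \<times> 't) set"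
  obtain f' where f': "\<And>p. p \<in> ?S \<Longrightarrow> ((\<lambda>(x, \<theta>). f x \<theta>) has_derivative blinfun_apply (f' p)) (at p)"
    and "C1_on ?S f'"
    using C2 unfolding C2_on_def by blast
  then obtain f'' where f'': "\<And>p. p \<in> ?S \<Longrightarrow> (f' has_derivative blinfun_apply (f'' p)) (at p)"
    and cont: "continuous_on ?S f''"
    unfolding C1_on_def by blast
  \<comment> \<open>Restricting a functional to the first factor and representing it by a vector is bounded linear.\<close>
  define T :: "(('x \<times> 't) \<Rightarrow>\<^sub>L real) \<Rightarrow>\<^sub>L 'x" where
    "T = Blinfun (\<lambda>\<phi>. \<Sum>i\<in>Basis. blinfun_apply \<phi> (i, 0) *\<^sub>R i)"
  have T: "blinfun_apply T \<phi> = (\<Sum>i\<in>Basis. blinfun_apply \<phi> (i, 0) *\<^sub>R i)" for \<phi>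
    unfolding T_def
    by (subst bounded_linear_Blinfun_apply) (auto intro!: bounded_linear_intros)
  have T_inner: "h \<bullet> blinfun_apply T \<phi> = blinfun_apply \<phi> (h, 0)" for h \<phi>
  proof -
    have "(h, 0) = (\<Sum>i\<in>Basis. (h \<bullet> i) *\<^sub>R (i, 0 :: 't))"
      by (rule prod_eqI) (simp_all add: fst_sum snd_sum euclidean_representation)
    then have "blinfun_apply \<phi> (h, 0) = (\<Sum>i\<in>Basis. (h \<bullet> i) * blinfun_apply \<phi> (i, 0))"
      by (simp only: blinfun.sum_right blinfun.scaleR_right real_scaleR_def)
    then show ?thesis
      by (simp add: T inner_sum_right mult.commute)
  qed
  have G: "GDERIV (\<lambda>z. f z \<theta>) x :> blinfun_apply T (f' (x, \<theta>))" if "\<theta> \<in> \<Theta>" for x \<theta>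
  proof -
    have "((\<lambda>z. (z, \<theta>)) has_derivative (\<lambda>h. (h, 0))) (at x)"
      by (intro has_derivative_Pair has_derivative_ident has_derivative_const)
    moreover have "((\<lambda>(x, \<theta>). f x \<theta>) has_derivative blinfun_apply (f' (x, \<theta>))) (at (x, \<theta>))"
      using f' that by simp
    ultimately have "((\<lambda>z. f z \<theta>) has_derivative (\<lambda>h. blinfun_apply (f' (x, \<theta>)) (h, 0))) (at x)"
      using has_derivative_compose[of "\<lambda>z. (z, \<theta>)" _ x UNIV "\<lambda>(x, \<theta>). f x \<theta>"] by simp
    then show ?thesis
      by (simp add: gderiv_def T_inner)
  qed
  note gradient_eq = gradient_eqI[OF G]
  show "GDERIV (\<lambda>z. f z \<theta>) x :> gradient (\<lambda>z. f z \<theta>) x" if "\<theta> \<in> \<Theta>" for x \<theta>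
    unfolding gradient_eq[OF that] by (rule G[OF that])
  have "((\<lambda>(x, \<theta>). gradient (\<lambda>z. f z \<theta>) x) has_derivative blinfun_apply (T o\<^sub>L f'' p)) (at p)"
    if "p \<in> ?S" for p
  proof (rule has_derivative_transform_within_open)
    show "((\<lambda>p. blinfun_apply T (f' p)) has_derivative blinfun_apply (T o\<^sub>L f'' p)) (at p)"
      using bounded_linear.has_derivative[OF blinfun.bounded_linear_right f''[OF that], of T]
      by (simp add: blinfun_compose.rep_eq o_def)
    show "open ?S"
      using \<open>open \<Theta>\<close> by (simp add: open_Times)
    show "p \<in> ?S" by (fact that)
    show "blinfun_apply T (f' q) = (case q of (x, \<theta>) \<Rightarrow> gradient (\<lambda>z. f z \<theta>) x)" if "q \<in> ?S" for q
      using that by (cases q) (simp add: gradient_eq)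
  qed
  moreover have "continuous_on ?S (\<lambda>p. T o\<^sub>L f'' p)"
    by (intro bounded_bilinear.continuous_on[OF bounded_bilinear_blinfun_compose] continuous_on_const cont)
  ultimately show "C1_on ?S (\<lambda>(x, \<theta>). gradient (\<lambda>z. f z \<theta>) x)"
    unfolding C1_on_def by (intro exI[of _ "\<lambda>p. T o\<^sub>L f'' p"] conjI ballI)
qed

text \<open>The implicit function theorem when the critical points are already given on all of \<open>\<Theta>\<close>. Since \<open>g\<close>
at the parameter \<open>\<theta>\<close> expands distances by at least \<open>\<mu>\<close> and is Lipschitz in the parameter, crossing from \<open>t\<close>
to \<open>\<theta>\<close> bounds \<open>xs t - xs \<theta>\<close> by a multiple of \<open>t - \<theta>\<close>, so the first order
expansion of \<open>g\<close> can be solved for it with an error that is small compared to \<open>t - \<theta>\<close>.\<close>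

lemma critical_point_has_derivative:
  fixes g :: "'x::euclidean_space \<Rightarrow> 't::euclidean_space \<Rightarrow> 'x"
  assumes "open \<Theta>" "\<theta> \<in> \<Theta>"
    and crit: "\<And>t. t \<in> \<Theta> \<Longrightarrow> g (xs t) t = 0"
    and g': "((\<lambda>(x, t). g x t) has_derivative g') (at (xs \<theta>, \<theta>))"
    and "\<mu> > 0" "L \<ge> 0"
    and strong: "\<And>y z. \<mu> * norm (y - z) \<le> norm (g y \<theta> - g z \<theta>)"
    and Lip: "\<And>x t. t \<in> \<Theta> \<Longrightarrow> norm (g x t - g x \<theta>) \<le> L * norm (t - \<theta>)"
    and coercive: "\<And>h. \<mu> * norm h \<le> norm (g' (h, 0))"
  obtains D where "(xs has_derivative D) (at \<theta>)" "\<And>h. g' (D h, h) = 0"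
proof -
  have lin: "linear g'"
    using g' by (rule has_derivative_linear)
  have g'_add: "g' (u, v) = g' (u, 0) + g' (0, v)" for u v
    using linear_add[OF lin, of "(u, 0)" "(0, v)"] by simp
  let ?A = "\<lambda>h. g' (h, 0)"
  have linA: "linear ?A"
    using linear_compose[OF _ lin, of "\<lambda>h. (h, 0)"] by (simp add: o_def linear_iff)
  have "inj ?A"
    unfolding linear_injective_0[OF linA]
  proof (intro allI impI)
    fix h assume "g' (h, 0) = 0"
    with coercive[of h] \<open>\<mu> > 0\<close> show "h = 0"
      by (simp add: mult_le_0_iff)
  qed
  then obtain B where "linear B" and AB: "\<And>h. g' (B h, 0) = h"
    using linear_injective_isomorphism[OF linA] by blast
  define D where "D h = - B (g' (0, h))" for h
  have "linear (\<lambda>h. g' (0, h))"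
    using linear_compose[OF _ lin, of "\<lambda>h. (0, h)"] by (simp add: o_def linear_iff)
  from linear_compose_neg[OF linear_compose[OF this \<open>linear B\<close>]] have "linear D"
    by (simp add: D_def[abs_def] o_def)
  then have "bounded_linear D"
    by (simp add: linear_conv_bounded_linear)
  have g'_D: "g' (D h, h) = 0" for h
  proof -
    have "g' (D h, 0) = - g' (0, h)"
      using linear_neg[OF linA] AB by (simp add: D_def)
    then show ?thesis using g'_add[of "D h" h] by simp
  qed
  define C where "C = 1 + L / \<mu>"
  have "C > 0"
    using \<open>\<mu> > 0\<close> \<open>L \<ge> 0\<close> by (simp add: C_def add_pos_nonneg)
  have bound: "norm ((xs t, t) - (xs \<theta>, \<theta>)) \<le> C * norm (t - \<theta>)" if "t \<in> \<Theta>" for t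
  proof -
    have "\<mu> * norm (xs t - xs \<theta>) \<le> norm (g (xs t) \<theta> - g (xs \<theta>) \<theta>)"
      by (rule strong)
    also have "\<dots> \<le> L * norm (t - \<theta>)"
      using Lip[OF that, of "xs t"] crit[OF that] crit[OF \<open>\<theta> \<in> \<Theta>\<close>] by simp
    finally have "norm (xs t - xs \<theta>) \<le> L / \<mu> * norm (t - \<theta>)"
      using \<open>\<mu> > 0\<close> by (simp add: field_simps)
    then show ?thesis
      using norm_Pair_le[of "xs t - xs \<theta>" "t - \<theta>"] by (simp add: C_def distrib_right)
  qed
  have "(xs has_derivative D) (at \<theta>)"
    unfolding has_derivative_at_alt
  proof (intro conjI allI impI)
    fix e :: real assume "0 < e"
    then have "0 < e * \<mu> / C"
      using \<open>\<mu> > 0\<close> \<open>C > 0\<close> by simp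
    then obtain d' where "d' > 0" and d': "\<And>p. norm (p - (xs \<theta>, \<theta>)) < d' \<Longrightarrow>
        norm ((case p of (x, t) \<Rightarrow> g x t) - g (xs \<theta>) \<theta> - g' (p - (xs \<theta>, \<theta>))) \<le> e * \<mu> / C * norm (p - (xs \<theta>, \<theta>))"
      using g'[unfolded has_derivative_at_alt, THEN conjunct2, rule_format, of "e * \<mu> / C"] by auto
    obtain r where "r > 0" and r: "ball \<theta> r \<subseteq> \<Theta>"
      using \<open>open \<Theta>\<close> \<open>\<theta> \<in> \<Theta>\<close> open_contains_ball by blast
    show "\<exists>d>0. \<forall>t. norm (t - \<theta>) < d \<longrightarrow> norm (xs t - xs \<theta> - D (t - \<theta>)) \<le> e * norm (t - \<theta>)"
    proof (intro exI[of _ "min r (d' / C)"] conjI allI impI)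
      fix t assume t: "norm (t - \<theta>) < min r (d' / C)"
      then have "t \<in> \<Theta>"
        using r by (auto simp: dist_norm norm_minus_commute subset_iff)
      have "norm ((xs t, t) - (xs \<theta>, \<theta>)) < d'"
        using bound[OF \<open>t \<in> \<Theta>\<close>] t \<open>C > 0\<close> by (simp add: field_simps)
      from d'[OF this] have "norm (g' ((xs t, t) - (xs \<theta>, \<theta>))) \<le> e * \<mu> / C * norm ((xs t, t) - (xs \<theta>, \<theta>))"
        using crit[OF \<open>t \<in> \<Theta>\<close>] crit[OF \<open>\<theta> \<in> \<Theta>\<close>] by simp
      also have "\<dots> \<le> e * \<mu> / C * (C * norm (t - \<theta>))"
        using \<open>0 < e * \<mu> / C\<close> bound[OF \<open>t \<in> \<Theta>\<close>] by (intro mult_left_mono) auto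
      also have "\<dots> = \<mu> * (e * norm (t - \<theta>))"
        using \<open>C > 0\<close> by simp
      also have "(xs t, t) - (xs \<theta>, \<theta>) = (xs t - xs \<theta> - D (t - \<theta>), 0) + (D (t - \<theta>), t - \<theta>)"
        by simp
      also have "g' \<dots> = g' (xs t - xs \<theta> - D (t - \<theta>), 0)"
        by (subst linear_add[OF lin]) (simp add: g'_D)
      finally have "\<mu> * norm (xs t - xs \<theta> - D (t - \<theta>)) \<le> \<mu> * (e * norm (t - \<theta>))"
        using coercive order.trans by blast
      with \<open>\<mu> > 0\<close> show "norm (xs t - xs \<theta> - D (t - \<theta>)) \<le> e * norm (t - \<theta>)"
        by simp
    qed (use \<open>r > 0\<close> \<open>d' > 0\<close> \<open>C > 0\<close> in simp)
  qed (fact \<open>bounded_linear D\<close>)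
  with g'_D show ?thesis
    using that by blast
qed

lemma inertial_pair_has_derivative:
  assumes g': "((\<lambda>(x, t). gradient (\<lambda>z. f z t) x) has_derivative g') (at (y, \<theta>))"
    and y: "y = (let (x, x') = inertial_pair f a b \<gamma> x0 \<theta> k in x + b k *\<^sub>R (x - x'))"
    and D: "((\<lambda>t. fst (inertial_pair f a b \<gamma> x0 t k)) has_derivative D) (at \<theta>)"
    and D': "((\<lambda>t. snd (inertial_pair f a b \<gamma> x0 t k)) has_derivative D') (at \<theta>)"
  shows "((\<lambda>t. fst (inertial_pair f a b \<gamma> x0 t (Suc k))) has_derivative
      (\<lambda>h. D h + a k *\<^sub>R (D h - D' h) - \<gamma> k *\<^sub>R g' (D h + b k *\<^sub>R (D h - D' h), h))) (at \<theta>)"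
proof -
  let ?x = "\<lambda>t. fst (inertial_pair f a b \<gamma> x0 t k)" and ?x' = "\<lambda>t. snd (inertial_pair f a b \<gamma> x0 t k)"
  let ?p = "\<lambda>t. (?x t + b k *\<^sub>R (?x t - ?x' t), t)"
  let ?G = "\<lambda>(x, t). gradient (\<lambda>z. f z t) x"
  have p_deriv: "(?p has_derivative (\<lambda>h. (D h + b k *\<^sub>R (D h - D' h), h))) (at \<theta>)"
    by (intro has_derivative_Pair has_derivative_diff has_derivative_add
        has_derivative_scaleR_right has_derivative_ident D D')
  have "(?G has_derivative g') (at (?p \<theta>))"
    using g' by (simp only: y case_prod_beta Let_def)
  from has_derivative_compose[OF p_deriv this]
  have "((\<lambda>t. gradient (\<lambda>z. f z t) (?x t + b k *\<^sub>R (?x t - ?x' t))) has_derivative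
      (\<lambda>h. g' (D h + b k *\<^sub>R (D h - D' h), h))) (at \<theta>)"
    by (simp only: prod.case)
  then have "((\<lambda>t. ?x t + a k *\<^sub>R (?x t - ?x' t)
        - \<gamma> k *\<^sub>R gradient (\<lambda>z. f z t) (?x t + b k *\<^sub>R (?x t - ?x' t))) has_derivative
      (\<lambda>h. D h + a k *\<^sub>R (D h - D' h) - \<gamma> k *\<^sub>R g' (D h + b k *\<^sub>R (D h - D' h), h))) (at \<theta>)"
    by (intro has_derivative_diff has_derivative_add has_derivative_scaleR_right D D')
  then show ?thesis
    by (simp only: inertial_pair.simps Let_def case_prod_beta fst_conv)
qed

lemma bounded_linear_stack:
  "bounded_linear (\<lambda>p :: (real^'n) \<times> (real^'n). stack (fst p) (snd p))"
  by (auto simp: linear_conv_bounded_linear[symmetric] stack_def vec_eq_iff split: sum.split intro!: linearI)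

lemma stack_has_derivative:
  fixes u v :: "'a::real_normed_vector \<Rightarrow> real^'n"
  assumes "(u has_derivative u') (at x within S)" "(v has_derivative v') (at x within S)"
  shows "((\<lambda>t. stack (u t) (v t)) has_derivative (\<lambda>h. stack (u' h) (v' h))) (at x within S)"
  using bounded_linear.has_derivative[OF bounded_linear_stack has_derivative_Pair[OF assms]] by simp

lemma tendsto_stack:
  fixes u v :: "'a \<Rightarrow> real^'n"
  assumes "(u \<longlongrightarrow> l) F" "(v \<longlongrightarrow> m) F"
  shows "((\<lambda>t. stack (u t) (v t)) \<longlongrightarrow> stack l m) F"
  using bounded_linear.tendsto[OF bounded_linear_stack tendsto_Pair[OF assms]] by simp

lemma jacobian_tendsto:
  fixes Y :: "nat \<Rightarrow> real^'m \<Rightarrow> real^'k"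
  assumes D: "\<And>k. (Y k has_derivative D k) (at \<theta>)" and E: "(Z has_derivative E) (at \<theta>)"
    and lim: "\<And>h. (\<lambda>k. D k h) \<longlonglongrightarrow> E h"
  shows "(\<lambda>k. op_norm (jacobian (Y k) (at \<theta>) - jacobian Z (at \<theta>))) \<longlonglongrightarrow> 0"
proof -
  have entry: "(jacobian (Y k) (at \<theta>) - jacobian Z (at \<theta>)) $ i $ j = (D k (axis j 1) - E (axis j 1)) $ i" for k i j
    using frechet_derivative_at[OF D[of k]] frechet_derivative_at[OF E]
    by (simp add: jacobian_def matrix_def)
  have "(\<lambda>k. \<Sum>i\<in>UNIV. \<Sum>j\<in>UNIV. \<bar>(D k (axis j 1) - E (axis j 1)) $ i\<bar>)
      \<longlonglongrightarrow> (\<Sum>i\<in>(UNIV::'k set). \<Sum>j\<in>(UNIV::'m set). \<bar>(E (axis j 1) - E (axis j 1)) $ i\<bar>)"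
    by (intro tendsto_intros lim)
  then have "(\<lambda>k. \<Sum>i\<in>UNIV. \<Sum>j\<in>UNIV. \<bar>(D k (axis j 1) - E (axis j 1)) $ i\<bar>) \<longlonglongrightarrow> 0"
    by simp
  then show ?thesis
  proof (rule tendsto_sandwich[rotated -1])
    show "\<forall>\<^sub>F k in sequentially. op_norm (jacobian (Y k) (at \<theta>) - jacobian Z (at \<theta>))
        \<le> (\<Sum>i\<in>UNIV. \<Sum>j\<in>UNIV. \<bar>(D k (axis j 1) - E (axis j 1)) $ i\<bar>)"
    proof (intro always_eventually allI)
      fix k
      show "op_norm (jacobian (Y k) (at \<theta>) - jacobian Z (at \<theta>))
          \<le> (\<Sum>i\<in>UNIV. \<Sum>j\<in>UNIV. \<bar>(D k (axis j 1) - E (axis j 1)) $ i\<bar>)"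
        using onorm_le_matrix_component_sum[of "jacobian (Y k) (at \<theta>) - jacobian Z (at \<theta>)"]
        by (simp only: entry op_norm_def)
    qed
    show "\<forall>\<^sub>F k in sequentially. 0 \<le> op_norm (jacobian (Y k) (at \<theta>) - jacobian Z (at \<theta>))"
      by (simp add: op_norm_def onorm_pos_le)
  qed simp
qed

section \<open>Convergence of the Jacobians\<close>

theorem theorem3p8:
  fixes \<Theta> :: "(real^'m) set"
    and f :: "real^'n \<Rightarrow> real^'m \<Rightarrow> real"
    and ak bk \<gamma>k :: "nat \<Rightarrow> real"
    and abar bbar L a b \<gamma> :: real
    and x0 :: "real^'m \<Rightarrow> real^'n"
  defines "H \<equiv> \<lambda>\<theta>. hessian (\<lambda>x. f x \<theta>) (optimal_point f \<theta>)"
    and "X \<equiv> inertial_state f ak bk \<gamma>k x0"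
    and "Xstar \<equiv> \<lambda>\<theta>. stack (optimal_point f \<theta>) (optimal_point f \<theta>)"
  assumes open_\<Theta>: "open \<Theta>"
    and A1: "C2_on (UNIV \<times> \<Theta>) (\<lambda>(x, \<theta>). f x \<theta>)"
    and A2: "\<And>\<theta>. \<theta> \<in> \<Theta> \<Longrightarrow> L-lipschitz_on UNIV (\<lambda>x. gradient (\<lambda>z. f z \<theta>) x)"
            "\<And>x. L-lipschitz_on \<Theta> (\<lambda>\<theta>. gradient (\<lambda>z. f z \<theta>) x)"
    and A3: "\<And>\<theta>. \<theta> \<in> \<Theta> \<Longrightarrow> level_bounded (\<lambda>x. f x \<theta>)"
    and strong: "\<And>\<theta>. \<theta> \<in> \<Theta> \<Longrightarrow> strongly_convex (\<lambda>x. f x \<theta>)"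
    and ak: "abar \<le> 1" "\<And>k. ak k \<in> {0..abar}"
    and bk: "bbar \<le> 1" "\<And>k. bk k \<in> {0..bbar}"
    and \<gamma>k: "\<And>k. 0 < \<gamma>k k" "\<And>k. \<gamma>k k < 2 / L"
    and B: "param_condition L ak bk \<gamma>k"
    and C1: "a \<in> {0..1}" "b \<in> {0..1}" "\<gamma> \<in> {0<..<2 / L}"
            "ak \<longlonglongrightarrow> a" "bk \<longlonglongrightarrow> b" "\<gamma>k \<longlonglongrightarrow> \<gamma>"
    and C2: "\<And>\<theta> a' b'. \<theta> \<in> \<Theta> \<Longrightarrow> seq_limit_point ak a' \<Longrightarrow> seq_limit_point bk b' \<Longrightarrow>
               a' \<in> {0..<1} \<Longrightarrow> b' \<in> {0..<1} \<Longrightarrow>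
               (2 * (b' - a') - 1) / (1 + 2 * b') < smallest_eigenvalue (mat 1 - \<gamma> *\<^sub>R H \<theta>)"
    and X0: "C1_on \<Theta> (X 0)"
  shows "\<forall>\<theta>\<in>\<Theta>.
           (\<forall>k. X k differentiable at \<theta>) \<and> Xstar differentiable at \<theta> \<and>
           (\<exists>\<epsilon>0>0. \<forall>\<epsilon>. 0 < \<epsilon> \<and> \<epsilon> < \<epsilon>0 \<longrightarrow> (\<exists>K. \<forall>k\<ge>K.
              op_norm (jacobian (X (k + 1)) (at \<theta>) - jacobian Xstar (at \<theta>))
              \<le> 2 * spectral_radius (inertial_matrix a b \<gamma> (H \<theta>))
                   * op_norm (jacobian (X k) (at \<theta>) - jacobian Xstar (at \<theta>))
                + \<epsilon> * (2 + op_norm (jacobian (X k) (at \<theta>) - jacobian Xstar (at \<theta>)))))"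
proof
  fix \<theta> assume \<theta>: "\<theta> \<in> \<Theta>"
  have L: "L > 0"
    using C1(3) by (metis greaterThanLessThan_iff order.strict_trans zero_less_divide_iff zero_less_numeral not_numeral_less_zero)
  have "\<gamma> > 0"
    using C1(3) by simp
  have ak01: "ak k \<in> {0..1}" and bk01: "bk k \<in> {0..1}" for k
    using ak(1) ak(2)[of k] bk(1) bk(2)[of k] by auto
  obtain \<tau> where \<tau>: "0 < \<tau>"
    "\<And>k. \<tau> < 1 - \<gamma>k k * L / 2 - \<bar>ak k - 2 * (\<gamma>k k * L / 2) * bk k\<bar> - \<gamma>k k * L / 2 * (bk k)\<^sup>2"
    using param_condition_margin[OF B L ak01 bk01 \<gamma>k] by blast
  note grad = C2_on_partial_gradient(1)[OF open_\<Theta> A1]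
  have scs_ex: "\<exists>\<nu>>0. strongly_convex_smooth \<nu> L (\<lambda>z. f z t) (gradient (\<lambda>z. f z t))" if "t \<in> \<Theta>" for t
    by (rule strongly_convex_smooth_if_Lipschitz_gradient[OF grad[OF that] A2(1)[OF that] strong[OF that]]) blast
  have crit: "gradient (\<lambda>z. f z t) (optimal_point f t) = 0" if "t \<in> \<Theta>" for t
  proof -
    from scs_ex[OF that] obtain \<nu>
      where \<nu>: "\<nu> > 0" "strongly_convex_smooth \<nu> L (\<lambda>z. f z t) (gradient (\<lambda>z. f z t))"
      by blast
    have "continuous_on UNIV (\<lambda>z. f z t)"
      using grad[OF that] unfolding gderiv_def
      by (auto intro!: continuous_at_imp_continuous_on has_derivative_continuous)
    from strongly_convex_smooth_minimizer[OF \<nu>(2,1) L this A3[OF that]] show ?thesis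
      by (simp add: optimal_point_def)
  qed
  obtain \<mu> where \<mu>: "\<mu> > 0" and scs: "strongly_convex_smooth \<mu> L (\<lambda>z. f z \<theta>) (gradient (\<lambda>z. f z \<theta>))"
    using scs_ex[OF \<theta>] by blast
  define xs where "xs = optimal_point f \<theta>"
  note crit\<theta> = crit[OF \<theta>, folded xs_def]

  obtain g' where g': "\<And>p. p \<in> UNIV \<times> \<Theta> \<Longrightarrow>
      ((\<lambda>(x, t). gradient (\<lambda>z. f z t) x) has_derivative blinfun_apply (g' p)) (at p)"
    and cont: "continuous_on (UNIV \<times> \<Theta>) g'"
    using C2_on_partial_gradient(2)[OF open_\<Theta> A1] unfolding C1_on_def by blast
  define A where "A = blinfun_apply (g' (xs, \<theta>))"
  have A: "((\<lambda>(x, t). gradient (\<lambda>z. f z t) x) has_derivative A) (at (xs, \<theta>))"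
    using g' \<theta> by (simp add: A_def)
  have A_partial: "(gradient (\<lambda>z. f z \<theta>) has_derivative (\<lambda>h. A (h, 0))) (at xs)"
  proof -
    have "((\<lambda>x. (x, \<theta>)) has_derivative (\<lambda>h. (h, 0))) (at xs)"
      by (intro has_derivative_Pair has_derivative_ident has_derivative_const)
    from has_derivative_compose[OF this A] show ?thesis by simp
  qed

  \<comment> \<open>The quadratic model of the objective at the minimizer.\<close>
  have model: "strongly_convex_smooth \<mu> L (\<lambda>z. 1 / 2 * (z \<bullet> A (z, 0))) (\<lambda>z. A (z, 0))"
    by (rule strongly_convex_smooth_linearization[OF grad[OF \<theta>] scs crit\<theta> A_partial])
  have A_coercive: "\<mu> * norm h \<le> norm (A (h, 0))" for h
    using strongly_convex_smooth_gradient_bound[OF model, of h 0]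
    by (simp add: A_def zero_prod_def[symmetric] blinfun.zero_right)

  obtain Ds where Ds: "(optimal_point f has_derivative Ds) (at \<theta>)" and A_Ds: "\<And>h. A (Ds h, h) = 0"
  proof (rule critical_point_has_derivative[where g = "\<lambda>x t. gradient (\<lambda>z. f z t) x"
        and xs = "optimal_point f" and g' = A and L = L, OF open_\<Theta> \<theta> _ _ \<mu>])
    show "gradient (\<lambda>z. f z t) (optimal_point f t) = 0" if "t \<in> \<Theta>" for t
      by (rule crit[OF that])
    show "((\<lambda>(x, t). gradient (\<lambda>z. f z t) x) has_derivative A) (at (optimal_point f \<theta>, \<theta>))"
      using A by (simp only: xs_def)
    show "\<mu> * norm (y - z) \<le> norm (gradient (\<lambda>z. f z \<theta>) y - gradient (\<lambda>z. f z \<theta>) z)" for y z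
      by (rule strongly_convex_smooth_gradient_bound[OF scs])
    show "norm (gradient (\<lambda>z. f z t) x - gradient (\<lambda>z. f z \<theta>) x) \<le> L * norm (t - \<theta>)" if "t \<in> \<Theta>" for x t
      using lipschitz_onD[OF A2(2) that \<theta>, of x] by (simp add: dist_norm)
    show "0 \<le> L" using L by simp
    show "\<mu> * norm h \<le> norm (A (h, 0))" for h by (rule A_coercive)
  qed (rule that)

  define ip where "ip = inertial_pair f ak bk \<gamma>k x0"
  define y where "y k = fst (ip \<theta> k) + bk k *\<^sub>R (fst (ip \<theta> k) - snd (ip \<theta> k))" for k
  have ip_lim: "ip \<theta> \<longlonglongrightarrow> (xs, xs)"
    unfolding ip_def
    by (rule inertial_pair_tendsto[where f = f, OF scs \<mu> L crit\<theta> ak01 bk01 \<gamma>k(1) \<tau> C1(4-6) \<open>\<gamma> > 0\<close>])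
  have "y \<longlonglongrightarrow> fst (xs, xs) + b *\<^sub>R (fst (xs, xs) - snd (xs, xs))"
    unfolding y_def[abs_def] by (intro tendsto_intros ip_lim C1(5))
  then have "(\<lambda>k. (y k, \<theta>)) \<longlonglongrightarrow> (xs, \<theta>)"
    by (auto intro: tendsto_Pair)
  then have g'_lim: "(\<lambda>k. g' (y k, \<theta>)) \<longlonglongrightarrow> g' (xs, \<theta>)"
    by (rule continuous_on_tendsto_compose[OF cont]) (use \<theta> in auto)

  have X_eq: "X k t = stack (fst (ip t k)) (snd (ip t k))" for k t
    by (simp add: X_def inertial_state_def ip_def case_prod_beta)
  define D where "D k = frechet_derivative (\<lambda>t. fst (ip t k)) (at \<theta>)" for k
  define D' where "D' k = frechet_derivative (\<lambda>t. snd (ip t k)) (at \<theta>)" for k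
  have step: "((\<lambda>t. fst (ip t (Suc k))) has_derivative (\<lambda>h. D k h + ak k *\<^sub>R (D k h - D' k h)
        - \<gamma>k k *\<^sub>R g' (y k, \<theta>) (D k h + bk k *\<^sub>R (D k h - D' k h), h))) (at \<theta>)"
    if "((\<lambda>t. fst (ip t k)) has_derivative D k) (at \<theta>)" "((\<lambda>t. snd (ip t k)) has_derivative D' k) (at \<theta>)" for k
    unfolding ip_def
  proof (rule inertial_pair_has_derivative)
    show "((\<lambda>(x, t). gradient (\<lambda>z. f z t) x) has_derivative blinfun_apply (g' (y k, \<theta>))) (at (y k, \<theta>))"
      using g' \<theta> by simp
    show "y k = (let (x, x') = inertial_pair f ak bk \<gamma>k x0 \<theta> k in x + bk k *\<^sub>R (x - x'))"
      by (simp add: y_def ip_def case_prod_beta)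
  qed (use that in \<open>simp_all add: ip_def\<close>)
  have snd_Suc: "snd (ip t (Suc k)) = fst (ip t k)" for t k
    by (simp only: ip_def inertial_pair_Suc)
  have deriv: "((\<lambda>t. fst (ip t k)) has_derivative D k) (at \<theta>) \<and> ((\<lambda>t. snd (ip t k)) has_derivative D' k) (at \<theta>)" for k
  proof (induction k)
    case 0
    obtain X' where "(X 0 has_derivative X') (at \<theta>)"
      using X0 \<theta> unfolding C1_on_def by blast
    \<comment> \<open>The assumption speaks of the stacked vector; the initial point is its first half.\<close>
    moreover have "bounded_linear (\<lambda>v :: real^('n + 'n). \<chi> i. v $ Inl i)"
      by (auto simp: linear_conv_bounded_linear[symmetric] vec_eq_iff intro!: linearI)
    ultimately have "((\<lambda>t. \<chi> i. X 0 t $ Inl i) has_derivative (\<lambda>h. \<chi> i. X' h $ Inl i)) (at \<theta>)"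
      by (rule bounded_linear.has_derivative[rotated])
    moreover have "(\<chi> i. X 0 t $ Inl i) = x0 t" for t
      by (simp add: X_eq stack_def ip_def)
    ultimately have "x0 differentiable at \<theta>"
      by (auto simp: differentiable_def)
    then show ?case
      by (simp add: D_def D'_def ip_def frechet_derivative_works[symmetric])
  next
    case (Suc k)
    then have "(\<lambda>t. fst (ip t (Suc k))) differentiable at \<theta>"
      using step unfolding differentiable_def by blast
    moreover have "(\<lambda>t. snd (ip t (Suc k))) differentiable at \<theta>"
      unfolding snd_Suc using Suc unfolding differentiable_def by blast
    ultimately show ?case
      unfolding D_def D'_def by (simp only: frechet_derivative_works[symmetric])
  qed
  have D'_Suc: "D' (Suc k) = D k" for k
    by (simp add: D_def D'_def snd_Suc)
  have D_Suc: "D (Suc k) h = D k h + ak k *\<^sub>R (D k h - D' k h)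
      - \<gamma>k k *\<^sub>R g' (y k, \<theta>) (D k h + bk k *\<^sub>R (D k h - D' k h), h)" for k h
    using has_derivative_unique[OF conjunct1[OF deriv] step[OF conjunct1[OF deriv] conjunct2[OF deriv]]]
    by (rule fun_cong)

  \<comment> \<open>The derivatives run the inertial method on the quadratic model, up to an error caused by
    evaluating the second derivatives away from the minimizer.\<close>
  have D_lim: "(\<lambda>k. D k h) \<longlonglongrightarrow> Ds h" for h
  proof -
    define v where "v k = D k h + bk k *\<^sub>R (D k h - D' k h)" for k
    define r where "r k = g' (y k, \<theta>) (v k, h) - A (v k, h)" for k
    define \<epsilon> where "\<epsilon> k = norm (g' (y k, \<theta>) - g' (xs, \<theta>)) * (1 + norm (Ds h) + norm h)" for k
    show ?thesis
    proof (rule inexact_inertial_method_converges[OF strongly_convex_smooth_shift[OF model, of "Ds h"] \<mu> L _ ak01 bk01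
          \<gamma>k(1) \<tau>(1) refl \<tau>(2) C1(4-6) \<open>\<gamma> > 0\<close>])
      show "A (Ds h - Ds h, 0) = 0"
        by (simp add: A_def zero_prod_def[symmetric] blinfun.zero_right)
      show "D (Suc k) h = D k h + (D (Suc k) h - D' (Suc k) h)" for k
        by (simp add: D'_Suc)
      show "v k = D k h + bk k *\<^sub>R (D k h - D' k h)" for k
        by (simp add: v_def)
      show "D (Suc k) h - D' (Suc k) h = ak k *\<^sub>R (D k h - D' k h) - \<gamma>k k *\<^sub>R (A (v k - Ds h, 0) + r k)" for k
      proof -
        have "A (v k - Ds h, 0) = A (v k, h) - A (Ds h, h)"
          by (simp add: A_def blinfun.diff_right[symmetric])
        then show ?thesis
          by (simp add: A_Ds r_def D'_Suc D_Suc v_def)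
      qed
      show "norm (r k) \<le> \<epsilon> k * (1 + norm (v k - Ds h))" for k
      proof -
        have "norm (r k) \<le> norm (g' (y k, \<theta>) - g' (xs, \<theta>)) * norm (v k, h)"
          unfolding r_def A_def blinfun.diff_left[symmetric] by (rule norm_blinfun)
        also have "norm (v k, h) \<le> (1 + norm (Ds h) + norm h) * (1 + norm (v k - Ds h))"
        proof -
          have "norm (v k, h) \<le> norm (v k - Ds h) + norm (Ds h) + norm h"
            using norm_Pair_le[of "v k" h] norm_triangle_sub[of "v k" "Ds h"] by linarith
          also have "\<dots> \<le> (1 + norm (Ds h) + norm h) * (1 + norm (v k - Ds h))"
            by (simp add: algebra_simps)
          finally show ?thesis .
        qed
        finally show ?thesis
          by (simp add: \<epsilon>_def mult_left_mono mult.assoc)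
      qed
      have "\<epsilon> \<longlonglongrightarrow> norm (g' (xs, \<theta>) - g' (xs, \<theta>)) * (1 + norm (Ds h) + norm h)"
        unfolding \<epsilon>_def[abs_def] by (intro tendsto_intros g'_lim)
      then show "\<epsilon> \<longlonglongrightarrow> 0" by simp
    qed
  qed
  have D'_lim: "(\<lambda>k. D' k h) \<longlonglongrightarrow> Ds h" for h
    by (rule LIMSEQ_imp_Suc) (simp add: D'_Suc D_lim)

  have X_deriv: "(X k has_derivative (\<lambda>h. stack (D k h) (D' k h))) (at \<theta>)" for k
    using stack_has_derivative[OF conjunct1[OF deriv] conjunct2[OF deriv], of k k] by (simp add: X_eq[abs_def])
  have Xstar_deriv: "(Xstar has_derivative (\<lambda>h. stack (Ds h) (Ds h))) (at \<theta>)"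
    unfolding Xstar_def by (rule stack_has_derivative[OF Ds Ds])
  let ?e = "\<lambda>k. op_norm (jacobian (X k) (at \<theta>) - jacobian Xstar (at \<theta>))"
  let ?\<rho> = "spectral_radius (inertial_matrix a b \<gamma> (H \<theta>))"
  have e_lim: "?e \<longlonglongrightarrow> 0"
    by (rule jacobian_tendsto[OF X_deriv Xstar_deriv]) (intro tendsto_stack D_lim D'_lim)
  have e_nonneg: "0 \<le> ?e k" for k
    by (simp add: op_norm_def onorm_pos_le)
  have "\<exists>K. \<forall>k\<ge>K. ?e (k + 1) \<le> 2 * ?\<rho> * ?e k + \<epsilon> * (2 + ?e k)" if "\<epsilon> > 0" for \<epsilon>
  proof -
    have "\<forall>\<^sub>F k in sequentially. ?e k < \<epsilon>"
      using e_lim that by (rule order_tendstoD)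
    then obtain K where K: "\<And>k. k \<ge> K \<Longrightarrow> ?e k < \<epsilon>"
      by (auto simp: eventually_sequentially)
    have "?e (k + 1) \<le> 2 * ?\<rho> * ?e k + \<epsilon> * (2 + ?e k)" if "k \<ge> K" for k
    proof -
      have "?e (k + 1) \<le> \<epsilon>"
        using K[of "k + 1"] that by simp
      also have "\<epsilon> \<le> \<epsilon> * (2 + ?e k)"
        using e_nonneg[of k] \<open>\<epsilon> > 0\<close> by (simp add: distrib_left)
      also have "\<dots> \<le> 2 * ?\<rho> * ?e k + \<epsilon> * (2 + ?e k)"
        using mult_nonneg_nonneg[OF spectral_radius_nonneg[of "inertial_matrix a b \<gamma> (H \<theta>)"] e_nonneg[of k]]
        by simp
      finally show ?thesis .
    qed
    then show ?thesis by blast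
  qed
  moreover have "X k differentiable at \<theta>" for k
    using X_deriv by (auto simp: differentiable_def)
  moreover have "Xstar differentiable at \<theta>"
    using Xstar_deriv by (auto simp: differentiable_def)
  ultimately show "(\<forall>k. X k differentiable at \<theta>) \<and> Xstar differentiable at \<theta> \<and>
      (\<exists>\<epsilon>0>0. \<forall>\<epsilon>. 0 < \<epsilon> \<and> \<epsilon> < \<epsilon>0 \<longrightarrow> (\<exists>K. \<forall>k\<ge>K.
         ?e (k + 1) \<le> 2 * ?\<rho> * ?e k + \<epsilon> * (2 + ?e k)))"
    by (intro conjI allI impI exI[of _ "1::real"]) auto
qed

end
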